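(* Let $I=(-r,r)$, $r>0$, let $c\colon I\to\mathbb{R}^4_2$ be a real analytic positive (respectively negative) regular good curve with associated frame $\{T,N,B_0,R\}$, and let $A,B\colon I\to\mathbb{R}^4_2$ be real analytic vector fields along $c$ such that, for every $t\in I$, $\{A(t),B(t)\}$ is an orthonormal set, $\mathrm{span}\{A(t),B(t)\}\subset\mathrm{span}\{N(t),B_0(t),R(t)\}$ and $[A(t)+iB(t)]\in Q^2_{neg}$ (respectively $[A(t)+iB(t)]\in Q^2_{pos}$). Then there is a connected and simply connected open set $M\subset\mathbb{C}$ with $I\subset M$, to which $c'$, $A$, $B$ extend holomorphically (the unique extensions being denoted $c_w$, $A$, $B\colon M\to\mathbb{C}^4$), such that $$f(w)=c(0)+\mathrm{Re}\int_{0}^{w}\bigl(c_w(\xi)-i\,\mathfrak{X}(c_w(\xi),A(\xi),B(\xi))\bigr)\,d\xi$$ defines a conformal immersion $f\colon M\to\mathbb{R}^4_2$ without metric singularities, with $[f_w(w)]\in Q^2_{pos}$ (respectively $Q^2_{neg}$) for all $w\in M$, and: (1) $f(t,0)=c(t)$ for all $t\in I$; (2) for all $t\in I$ the normal plane of $f$ at $(t,0)$ is $\mathrm{span}\{A(t),B(t)\}$; (3) the mean curvature vector $H_f$ vanishes identically on $M$. Moreover $M$ can be chosen maximal with respect to inclusion among the connected and simply connected open subsets of $\mathbb{C}$ containing $I$ with these properties.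
   Context: $\mathbb{R}^4_2$ is $\mathbb{R}^4$ with $\langle v,w\rangle=-v^1w^1-v^2w^2+v^3w^3+v^4w^4$ and volume form $\omega=dx^1\wedge dx^2\wedge dx^3\wedge dx^4$. A regular curve is positive (negative) if $\langle c',c'\rangle>0$ ($<0$) everywhere. The cross product $\mathfrak{X}(x,y,z)$ is the unique vector with $\omega(x,y,z,v)=\langle\mathfrak{X}(x,y,z),v\rangle$ for all $v$; it is extended complex-trilinearly to $\mathbb{C}^4$. A set $\{A,B\}$ is orthonormal if $\langle A,B\rangle=0$ and $|\langle A,A\rangle|=|\langle B,B\rangle|=1$. On $\mathbb{C}^4$, $\ll\cdot,\cdot\gg$ is the complex-bilinear extension of $\langle\cdot,\cdot\rangle$; $Q^2_{pos}$ (resp. $Q^2_{neg}$) is the set of $[z]\in\mathbb{C}P^3$ with $\ll z,z\gg=0$ and $\ll z,\bar z\gg>0$ (resp. $<0$). A point $[x+iy]$ of one of these sets represents the plane $\mathrm{span}\{x,y\}\subset\mathbb{R}^4_2$. For $w=u+iv$, $f_w=\frac12(f_u-if_v)$, and points $u+iv$ of $M$ are also written $(u,v)$. A metric singularity is a point where the induced metric is degenerate. A positive regular curve $c$ is a good curve if there is a frame $\{T,N,B_0,R\}$ along $c$, a positively oriented orthonormal basis of $\mathbb{R}^4_2$ at each point, such that (i) $c'=vT$ with $\langle c',c'\rangle=v^2>0$; (ii) $N\in\mathrm{span}\{c',c''\}$, $|\langle N,N\rangle|=1$; (iii) $B_0\in\mathrm{span}\{c',c'',c'''\}$, $|\langle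 B_0,B_0\rangle|=1$; (iv) $R=\mathfrak{X}(T,N,B_0)$. Good negative curves are defined in the same way, with $\langle c',c'\rangle=-v^2<0$ in (i). *)

theory Defs
  imports "HOL-Complex_Analysis.Complex_Analysis"
begin

section \<open>The pseudo-Euclidean space of signature (2,2)\<close>

text \<open>
  Over the reals \<open>ip\<close> is the scalar product of $\mathbb{R}^4_2$; over the complex numbers the
  same formula is its complex-bilinear extension. Likewise \<open>vol4\<close> is
  $dx^1\wedge dx^2\wedge dx^3\wedge dx^4$, the determinant of the matrix of components.
\<close>

definition ip :: "'a::comm_ring_1 ^ 4 \<Rightarrow> 'a ^ 4 \<Rightarrow> 'a" where
  "ip x y = - (x $ 1 * y $ 1) - x $ 2 * y $ 2 + x $ 3 * y $ 3 + x $ 4 * y $ 4"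

definition vol4 :: "real ^ 4 \<Rightarrow> real ^ 4 \<Rightarrow> real ^ 4 \<Rightarrow> real ^ 4 \<Rightarrow> real" where
  "vol4 x y z v = det (vector [x, y, z, v] :: real ^ 4 ^ 4)"

definition cross :: "real ^ 4 \<Rightarrow> real ^ 4 \<Rightarrow> real ^ 4 \<Rightarrow> real ^ 4" where
  "cross x y z = (THE p. \<forall>v. vol4 x y z v = ip p v)"

definition orthonormal_pair :: "real ^ 4 \<Rightarrow> real ^ 4 \<Rightarrow> bool" where
  "orthonormal_pair x y \<longleftrightarrow> ip x y = 0 \<and> \<bar>ip x x\<bar> = 1 \<and> \<bar>ip y y\<bar> = 1"

definition cvec :: "real ^ 4 \<Rightarrow> complex ^ 4" where
  "cvec x = (\<chi> i. complex_of_real (x $ i))"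

definition Re_vec :: "complex ^ 4 \<Rightarrow> real ^ 4" where
  "Re_vec z = (\<chi> i. Re (z $ i))"

definition cnj_vec :: "complex ^ 4 \<Rightarrow> complex ^ 4" where
  "cnj_vec z = (\<chi> i. cnj (z $ i))"

text \<open>The complex-trilinear extension of \<open>cross\<close>, determined by its values on the standard basis.\<close>

definition ccross :: "complex ^ 4 \<Rightarrow> complex ^ 4 \<Rightarrow> complex ^ 4 \<Rightarrow> complex ^ 4" where
  "ccross x y z = (\<Sum>i\<in>UNIV. \<Sum>j\<in>UNIV. \<Sum>k\<in>UNIV.
     (x $ i * y $ j * z $ k) *s cvec (cross (axis i 1) (axis j 1) (axis k 1)))"

lemma ip_unique:
  fixes p q :: "real ^ 4"
  assumes "\<And>v. ip p v = ip q v"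
  shows "p = q"
proof -
  have "p $ i = q $ i" for i
    using assms[of "axis i 1"] exhaust_4[of i] by (auto simp: ip_def axis_def)
  then show ?thesis by (simp add: vec_eq_iff)
qed

lemma vol4_linear: "linear (vol4 x y z)"
proof -
  have *: "vol4 x y z v = det (\<chi> i. if i = 4 then v else (vector [x, y, z, 0] :: real ^ 4 ^ 4) $ i)" for v
    unfolding vol4_def
    by (rule arg_cong[where f = det]) (auto simp: vec_eq_iff vector_def forall_4)
  show ?thesis
    by (rule linearI) (simp_all add: * det_row_add det_row_mul scalar_mult_eq_scaleR[symmetric])
qed

lemma cross_ex1: "\<exists>!p. \<forall>v. vol4 x y z v = ip p v"
proof -
  let ?d = "\<lambda>i. vol4 x y z (axis i 1)"
  define p :: "real ^ 4" where "p = vector [- ?d 1, - ?d 2, ?d 3, ?d 4]"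
  have "vol4 x y z v = ip p v" for v
  proof -
    have "vol4 x y z v = vol4 x y z (\<Sum>i\<in>UNIV. v $ i *\<^sub>R axis i 1)"
      by (simp add: basis_expansion[of v, unfolded scalar_mult_eq_scaleR])
    also have "\<dots> = (\<Sum>i\<in>UNIV. v $ i * ?d i)"
      by (simp add: linear_sum[OF vol4_linear] linear_cmul[OF vol4_linear])
    also have "\<dots> = ip p v"
      by (simp add: sum_4 ip_def p_def vector_def)
    finally show ?thesis .
  qed
  then show ?thesis
    by (metis ip_unique)
qed

lemma vol4_eq_ip_cross: "vol4 x y z v = ip (cross x y z) v"
  using theI'[OF cross_ex1[of x y z]] unfolding cross_def by blast

lemma ip_add_left: "ip (x + y) z = ip x z + ip y z"
  by (simp add: ip_def algebra_simps)

lemma ip_scale_left: "ip (k *s x) z = k * ip x z"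
  by (simp add: ip_def algebra_simps)

lemma cross_linear:
  shows "linear (\<lambda>x. cross x y z)" "linear (\<lambda>y. cross x y z)" "linear (\<lambda>z. cross x y z)"
proof -
  have 1: "vol4 x y z v = det (\<chi> i. if i = 1 then x else (vector [0, y, z, v] :: real ^ 4 ^ 4) $ i)"
   and 2: "vol4 x y z v = det (\<chi> i. if i = 2 then y else (vector [x, 0, z, v] :: real ^ 4 ^ 4) $ i)"
   and 3: "vol4 x y z v = det (\<chi> i. if i = 3 then z else (vector [x, y, 0, v] :: real ^ 4 ^ 4) $ i)"
   for x y z v
    unfolding vol4_def
    by (rule arg_cong[where f = det], auto simp: vec_eq_iff vector_def forall_4)+
  note [simp] = ip_add_left ip_scale_left vol4_eq_ip_cross[symmetric]
    det_row_add det_row_mul scalar_mult_eq_scaleR[symmetric]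
  show "linear (\<lambda>x. cross x y z)"
    by (rule linearI; rule ip_unique) (simp_all add: 1)
  show "linear (\<lambda>y. cross x y z)"
    by (rule linearI; rule ip_unique) (simp_all add: 2)
  show "linear (\<lambda>z. cross x y z)"
    by (rule linearI; rule ip_unique) (simp_all add: 3)
qed

lemma ccross_cvec: "ccross (cvec x) (cvec y) (cvec z) = cvec (cross x y z)"
proof -
  have e: "w = (\<Sum>i\<in>UNIV. w $ i *\<^sub>R axis i 1)" for w :: "real ^ 4"
    by (simp add: basis_expansion[of w, unfolded scalar_mult_eq_scaleR])
  have "cross x y z = cross (\<Sum>i\<in>UNIV. x $ i *\<^sub>R axis i 1) (\<Sum>i\<in>UNIV. y $ i *\<^sub>R axis i 1)
          (\<Sum>i\<in>UNIV. z $ i *\<^sub>R axis i 1)"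
    using e[of x] e[of y] e[of z] by simp
  also have "\<dots> = (\<Sum>i\<in>UNIV. \<Sum>j\<in>UNIV. \<Sum>k\<in>UNIV.
      (x $ i * y $ j * z $ k) *\<^sub>R cross (axis i 1) (axis j 1) (axis k 1))"
    unfolding linear_sum[OF cross_linear(1)] linear_cmul[OF cross_linear(1)]
    unfolding linear_sum[OF cross_linear(2)] linear_cmul[OF cross_linear(2)]
    unfolding linear_sum[OF cross_linear(3)] linear_cmul[OF cross_linear(3)]
    by (simp add: scaleR_sum_right mult.assoc)
  finally show ?thesis
    by (simp add: ccross_def cvec_def vec_eq_iff)
qed


section \<open>The quadrics in complex projective space\<close>

text \<open>
  A point of $\mathbb{C}P^3$ is the complex line through a nonzero vector. The number
  \<open>ip z (cnj_vec z)\<close> is always real, so its sign is that of its real part.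
\<close>

definition cline :: "complex ^ 4 \<Rightarrow> (complex ^ 4) set" where
  "cline z = range (\<lambda>k. k *s z)"

definition Q_pos :: "(complex ^ 4) set set" where
  "Q_pos = {cline z | z. z \<noteq> 0 \<and> ip z z = 0 \<and> Re (ip z (cnj_vec z)) > 0}"

definition Q_neg :: "(complex ^ 4) set set" where
  "Q_neg = {cline z | z. z \<noteq> 0 \<and> ip z z = 0 \<and> Re (ip z (cnj_vec z)) < 0}"

lemma Im_ip_cnj_vec: "Im (ip z (cnj_vec z)) = 0"
  by (simp add: ip_def cnj_vec_def)


section \<open>Curves\<close>

definition real_analytic_on :: "(real \<Rightarrow> 'a::real_normed_vector) \<Rightarrow> real set \<Rightarrow> bool" where
  "real_analytic_on g S \<longleftrightarrow> (\<forall>t0\<in>S. \<exists>e>0. \<exists>a.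
     \<forall>t\<in>S. \<bar>t - t0\<bar> < e \<longrightarrow> (\<lambda>n. (t - t0) ^ n *\<^sub>R a n) sums g t)"

definition vel :: "(real \<Rightarrow> real ^ 4) \<Rightarrow> real \<Rightarrow> real ^ 4" where
  "vel c t = vector_derivative c (at t)"

definition regular_curve :: "real set \<Rightarrow> (real \<Rightarrow> real ^ 4) \<Rightarrow> bool" where
  "regular_curve I c \<longleftrightarrow> (\<forall>t\<in>I. c differentiable (at t) \<and> vel c t \<noteq> 0)"

definition positive_curve :: "real set \<Rightarrow> (real \<Rightarrow> real ^ 4) \<Rightarrow> bool" where
  "positive_curve I c \<longleftrightarrow> regular_curve I c \<and> (\<forall>t\<in>I. ip (vel c t) (vel c t) > 0)"

definition negative_curve :: "real set \<Rightarrow> (real \<Rightarrow> real ^ 4) \<Rightarrow> bool" where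
  "negative_curve I c \<longleftrightarrow> regular_curve I c \<and> (\<forall>t\<in>I. ip (vel c t) (vel c t) < 0)"

text \<open>Positive orientation, \<open>vol4 T N B0 R > 0\<close>, already makes the four vectors a basis.\<close>

definition oriented_orthonormal_basis ::
  "real ^ 4 \<Rightarrow> real ^ 4 \<Rightarrow> real ^ 4 \<Rightarrow> real ^ 4 \<Rightarrow> bool" where
  "oriented_orthonormal_basis T N B0 R \<longleftrightarrow>
     orthonormal_pair T N \<and> orthonormal_pair T B0 \<and> orthonormal_pair T R \<and>
     orthonormal_pair N B0 \<and> orthonormal_pair N R \<and> orthonormal_pair B0 R \<and>
     vol4 T N B0 R > 0"

text \<open>The two kinds of good curves differ only in the sign \<open>s\<close> of $\langle c', c'\rangle$.\<close>

definition good_frame :: "real \<Rightarrow> real set \<Rightarrow> (real \<Rightarrow> real ^ 4) \<Rightarrow> (real \<Rightarrow> real ^ 4) \<Rightarrow>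
    (real \<Rightarrow> real ^ 4) \<Rightarrow> (real \<Rightarrow> real ^ 4) \<Rightarrow> (real \<Rightarrow> real ^ 4) \<Rightarrow> bool" where
  "good_frame s I c T N B0 R \<longleftrightarrow> (\<forall>t\<in>I.
     oriented_orthonormal_basis (T t) (N t) (B0 t) (R t) \<and>
     (\<exists>v::real. vel c t = v *\<^sub>R T t \<and> ip (vel c t) (vel c t) = s * v\<^sup>2 \<and> v\<^sup>2 > 0) \<and>
     N t \<in> span {vel c t, vel (vel c) t} \<and> \<bar>ip (N t) (N t)\<bar> = 1 \<and>
     B0 t \<in> span {vel c t, vel (vel c) t, vel (vel (vel c)) t} \<and> \<bar>ip (B0 t) (B0 t)\<bar> = 1 \<and>
     R t = cross (T t) (N t) (B0 t))"

definition good_positive_curve :: "real set \<Rightarrow> (real \<Rightarrow> real ^ 4) \<Rightarrow> (real \<Rightarrow> real ^ 4) \<Rightarrow>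
    (real \<Rightarrow> real ^ 4) \<Rightarrow> (real \<Rightarrow> real ^ 4) \<Rightarrow> (real \<Rightarrow> real ^ 4) \<Rightarrow> bool" where
  "good_positive_curve I c T N B0 R \<longleftrightarrow> positive_curve I c \<and> good_frame 1 I c T N B0 R"

definition good_negative_curve :: "real set \<Rightarrow> (real \<Rightarrow> real ^ 4) \<Rightarrow> (real \<Rightarrow> real ^ 4) \<Rightarrow>
    (real \<Rightarrow> real ^ 4) \<Rightarrow> (real \<Rightarrow> real ^ 4) \<Rightarrow> (real \<Rightarrow> real ^ 4) \<Rightarrow> bool" where
  "good_negative_curve I c T N B0 R \<longleftrightarrow> negative_curve I c \<and> good_frame (-1) I c T N B0 R"


section \<open>Surfaces\<close>

definition d_u :: "(complex \<Rightarrow> real ^ 4) \<Rightarrow> complex \<Rightarrow> real ^ 4" where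
  "d_u f p = frechet_derivative f (at p) 1"

definition d_v :: "(complex \<Rightarrow> real ^ 4) \<Rightarrow> complex \<Rightarrow> real ^ 4" where
  "d_v f p = frechet_derivative f (at p) \<i>"

definition d_w :: "(complex \<Rightarrow> real ^ 4) \<Rightarrow> complex \<Rightarrow> complex ^ 4" where
  "d_w f p = (1/2) *s (cvec (d_u f p) - \<i> *s cvec (d_v f p))"

text \<open>\<open>Ck_on k M f\<close>, for open \<open>M\<close>: \<open>f\<close> is of class $C^k$ on \<open>M\<close>.\<close>

primrec Ck_on :: "nat \<Rightarrow> complex set \<Rightarrow> (complex \<Rightarrow> real ^ 4) \<Rightarrow> bool" where
  "Ck_on 0 M f \<longleftrightarrow> continuous_on M f"
| "Ck_on (Suc k) M f \<longleftrightarrow>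
     (\<forall>p\<in>M. f differentiable (at p)) \<and> Ck_on k M (d_u f) \<and> Ck_on k M (d_v f)"

definition immersion_on :: "complex set \<Rightarrow> (complex \<Rightarrow> real ^ 4) \<Rightarrow> bool" where
  "immersion_on M f \<longleftrightarrow> (\<forall>k. Ck_on k M f) \<and> (\<forall>p\<in>M. inj (frechet_derivative f (at p)))"

definition induced_metric :: "(complex \<Rightarrow> real ^ 4) \<Rightarrow> complex \<Rightarrow> complex \<Rightarrow> complex \<Rightarrow> real" where
  "induced_metric f p X Y = ip (frechet_derivative f (at p) X) (frechet_derivative f (at p) Y)"

text \<open>
  The conformal factor is not required to be positive: for negative curves the induced metric
  is negative definite. That the factor is nonzero is the absence of metric singularities.
\<close>

definition conformal_on :: "complex set \<Rightarrow> (complex \<Rightarrow> real ^ 4) \<Rightarrow> bool" where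
  "conformal_on M f \<longleftrightarrow> (\<forall>p\<in>M. \<exists>l. \<forall>X Y. induced_metric f p X Y = l * (X \<bullet> Y))"

definition metric_singularity :: "(complex \<Rightarrow> real ^ 4) \<Rightarrow> complex \<Rightarrow> bool" where
  "metric_singularity f p \<longleftrightarrow> (\<exists>X. X \<noteq> 0 \<and> (\<forall>Y. induced_metric f p X Y = 0))"

definition tangent_plane :: "(complex \<Rightarrow> real ^ 4) \<Rightarrow> complex \<Rightarrow> (real ^ 4) set" where
  "tangent_plane f p = range (frechet_derivative f (at p))"

definition normal_plane :: "(complex \<Rightarrow> real ^ 4) \<Rightarrow> complex \<Rightarrow> (real ^ 4) set" where
  "normal_plane f p = {n. \<forall>x\<in>tangent_plane f p. ip x n = 0}"

text \<open>
  At a point of an immersion that is not a metric singularity, $\mathbb{R}^4_2$ is the direct sum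
  of the tangent and the normal plane.
\<close>

definition normal_part :: "(complex \<Rightarrow> real ^ 4) \<Rightarrow> complex \<Rightarrow> real ^ 4 \<Rightarrow> real ^ 4" where
  "normal_part f p x = (THE n. n \<in> normal_plane f p \<and> x - n \<in> tangent_plane f p)"

text \<open>
  Half the trace, with respect to the induced metric, of the second fundamental form, whose
  coefficients are the normal parts of $f_{uu}$, $f_{uv}$, $f_{vv}$.
\<close>

definition mean_curvature :: "(complex \<Rightarrow> real ^ 4) \<Rightarrow> complex \<Rightarrow> real ^ 4" where
  "mean_curvature f p =
     (let E = induced_metric f p 1 1; F = induced_metric f p 1 \<i>; G = induced_metric f p \<i> \<i>
      in (1 / (2 * (E * G - F\<^sup>2))) *\<^sub>R
           (G *\<^sub>R normal_part f p (d_u (d_u f) p)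
            - (2 * F) *\<^sub>R normal_part f p (d_v (d_u f) p)
            + E *\<^sub>R normal_part f p (d_v (d_v f) p)))"


section \<open>Holomorphic extension and the representation formula\<close>

definition holo_extension ::
  "real set \<Rightarrow> (real \<Rightarrow> real ^ 4) \<Rightarrow> complex set \<Rightarrow> (complex \<Rightarrow> complex ^ 4) \<Rightarrow> bool" where
  "holo_extension I g M h \<longleftrightarrow>
     (\<forall>i. (\<lambda>w. h w $ i) holomorphic_on M) \<and> (\<forall>t\<in>I. h (complex_of_real t) = cvec (g t))"

definition unique_holo_extension ::
  "real set \<Rightarrow> (real \<Rightarrow> real ^ 4) \<Rightarrow> complex set \<Rightarrow> (complex \<Rightarrow> complex ^ 4) \<Rightarrow> bool" where
  "unique_holo_extension I g M h \<longleftrightarrow>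
     holo_extension I g M h \<and> (\<forall>h'. holo_extension I g M h' \<longrightarrow> (\<forall>w\<in>M. h' w = h w))"

text \<open>
  \<open>J\<close> is the value of the integral of \<open>F\<close> from \<open>a\<close> to \<open>b\<close> in \<open>M\<close>: the integral along every
  path in \<open>M\<close> from \<open>a\<close> to \<open>b\<close> exists and equals \<open>J\<close>.
\<close>

definition has_integral_from_to :: "(complex \<Rightarrow> complex ^ 4) \<Rightarrow> complex ^ 4 \<Rightarrow> complex set \<Rightarrow>
    complex \<Rightarrow> complex \<Rightarrow> bool" where
  "has_integral_from_to F J M a b \<longleftrightarrow>
     (\<forall>\<gamma>. valid_path \<gamma> \<and> path_image \<gamma> \<subseteq> M \<and> pathstart \<gamma> = a \<and> pathfinish \<gamma> = b \<longrightarrow>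
        (\<forall>i. ((\<lambda>\<xi>. F \<xi> $ i) has_contour_integral J $ i) \<gamma>))"

text \<open>
  \<open>bjorling_domain Q I c A B M\<close>: the domain \<open>M\<close> has all the properties claimed for the
  solution of the Bjorling problem with data \<open>c\<close>, \<open>A\<close>, \<open>B\<close>; \<open>Q\<close> is the quadric containing the
  points $[f_w]$.
\<close>

definition bjorling_domain :: "(complex ^ 4) set set \<Rightarrow> real set \<Rightarrow> (real \<Rightarrow> real ^ 4) \<Rightarrow>
    (real \<Rightarrow> real ^ 4) \<Rightarrow> (real \<Rightarrow> real ^ 4) \<Rightarrow> complex set \<Rightarrow> bool" where
  "bjorling_domain Q I c A B M \<longleftrightarrow>
     open M \<and> connected M \<and> simply_connected M \<and> complex_of_real ` I \<subseteq> M \<and>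
     (\<exists>cw Aw Bw f.
        unique_holo_extension I (vel c) M cw \<and>
        unique_holo_extension I A M Aw \<and>
        unique_holo_extension I B M Bw \<and>
        (\<forall>w\<in>M. \<exists>J.
           has_integral_from_to (\<lambda>\<xi>. cw \<xi> - \<i> *s ccross (cw \<xi>) (Aw \<xi>) (Bw \<xi>)) J M 0 w \<and>
           f w = c 0 + Re_vec J) \<and>
        immersion_on M f \<and> conformal_on M f \<and>
        (\<forall>w\<in>M. \<not> metric_singularity f w) \<and>
        (\<forall>w\<in>M. cline (d_w f w) \<in> Q) \<and>
        (\<forall>t\<in>I. f (complex_of_real t) = c t) \<and>
        (\<forall>t\<in>I. normal_plane f (complex_of_real t) = span {A t, B t}) \<and>
        (\<forall>w\<in>M. mean_curvature f w = 0))"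

end

theory Submission
  imports Defs
begin

text \<open>
  The formula is a Weierstrass representation. Put $\varphi = c_w - i\,\mathfrak{X}(c_w, A, B)$.
  The surface \<open>f\<close> is the real part of a primitive of $\varphi$, so its differential is
  $X \mapsto \mathrm{Re}(X\varphi)$, $f_w = \varphi/2$, and \<open>f\<close> is harmonic.

  Along \<open>I\<close> the fields \<open>A\<close> and \<open>B\<close> are orthonormal of the same sign and orthogonal to
  the velocity. The cross product of \<open>c'\<close>, \<open>A\<close>, \<open>B\<close> is orthogonal to \<open>c'\<close>, and by
  the Gram identity \<open>ip_cross_cross\<close> it has the same scalar square
  (\<open>bjorling_form_isotropic\<close>). Thus $\varphi$ is isotropic on \<open>I\<close>, and by the identity theorem
  on every connected domain (\<open>form_isotropic\<close>). Isotropy means that \<open>f\<close> is conformal with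
  factor half the Hermitian square of $\varphi$ (\<open>isotropic_conformal\<close>), and a conformal
  harmonic map without metric singularities has zero mean curvature
  (\<open>mean_curvature_conformal_harmonic\<close>). On \<open>I\<close> the real and imaginary parts of $\varphi$
  are \<open>c'\<close> and minus the cross product, which gives the initial curve and its normal planes.

  Consequently the only condition that restricts the domain, beyond the existence of the
  extensions, is the sign of the Hermitian square of $\varphi$, which on \<open>I\<close> is twice the
  scalar square of the velocity. The lemmas \<open>bjorling_domain_imp_solvable\<close> and
  \<open>solvable_imp_bjorling_domain\<close> state this reduction. The reduced condition is local, and
  solutions glue along overlaps that meet \<open>I\<close> (\<open>solvable_Union\<close>). This is used twice. For
  existence the pieces are small discs centred on \<open>I\<close>, whose union is contracted vertically to
  \<open>I\<close> and so is simply connected. For maximality they are the members of a chain in Zorn's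
  lemma, where simple connectedness passes to the union because loops are compact.
\<close>

(* The dollar sign is kept for the components of vectors. *)
no_notation fps_nth (infixl "$" 75)

section \<open>The cross product\<close>

text \<open>
  The expansion along the first row, which gives the components of a cross product.
\<close>

lemma det_4:
  fixes M :: "'a::comm_ring_1 ^ 4 ^ 4"
  defines "m \<equiv> \<lambda>j k l. M $ 2 $ j * (M $ 3 $ k * M $ 4 $ l - M $ 3 $ l * M $ 4 $ k)
      - M $ 2 $ k * (M $ 3 $ j * M $ 4 $ l - M $ 3 $ l * M $ 4 $ j)
      + M $ 2 $ l * (M $ 3 $ j * M $ 4 $ k - M $ 3 $ k * M $ 4 $ j)"
  shows "det M = M $ 1 $ 1 * m 2 3 4 - M $ 1 $ 2 * m 1 3 4 + M $ 1 $ 3 * m 1 2 4 - M $ 1 $ 4 * m 1 2 3"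
proof -
  have f1234: "finite {2::4, 3, 4}" "1 \<notin> {2::4, 3, 4}" by auto
  have f234: "finite {3::4, 4}" "2 \<notin> {3::4, 4}" by auto
  have f34: "finite {4::4}" "3 \<notin> {4::4}" by auto
  show ?thesis
    unfolding det_def UNIV_4 m_def
    unfolding sum_over_permutations_insert[OF f1234]
    unfolding sum_over_permutations_insert[OF f234]
    unfolding sum_over_permutations_insert[OF f34]
    unfolding permutes_sing
    by (simp add: sign_swap_id permutation_swap_id sign_compose sign_id permutation_compose swap_id_eq) (simp add: algebra_simps)
qed

lemma vector_4:
  "(vector [a, b, c, d] :: 'a::zero ^ 4) $ 1 = a" "(vector [a, b, c, d] :: 'a ^ 4) $ 2 = b"
  "(vector [a, b, c, d] :: 'a ^ 4) $ 3 = c" "(vector [a, b, c, d] :: 'a ^ 4) $ 4 = d"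
  by (simp_all add: vector_def)

text \<open>
  These are the $3\times 3$ minors of the matrix with rows \<open>x\<close>, \<open>y\<close>, \<open>z\<close>; up to
  sign they are the components of the cross product.
\<close>

definition minor3 :: "4 \<Rightarrow> 4 \<Rightarrow> 4 \<Rightarrow> real ^ 4 \<Rightarrow> real ^ 4 \<Rightarrow> real ^ 4 \<Rightarrow> real" where
  "minor3 j k l x y z = x $ j * (y $ k * z $ l - y $ l * z $ k)
      - x $ k * (y $ j * z $ l - y $ l * z $ j) + x $ l * (y $ j * z $ k - y $ k * z $ j)"

lemma cross_components:
  "cross x y z = vector [minor3 2 3 4 x y z, - minor3 1 3 4 x y z, - minor3 1 2 4 x y z, minor3 1 2 3 x y z]"
    (is "_ = ?p")
proof (rule ip_unique)
  fix v
  show "ip (cross x y z) v = ip ?p v"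
    unfolding vol4_eq_ip_cross[symmetric]
    unfolding vol4_def det_4 ip_def minor3_def vector_4 by algebra
qed

lemma ip_cross_orthogonal:
  "ip (cross x y z) x = 0" "ip (cross x y z) y = 0" "ip (cross x y z) z = 0"
  unfolding cross_components ip_def minor3_def vector_4 by algebra+

text \<open>
  The right-hand side is the Gram determinant of \<open>x\<close>, \<open>y\<close>, \<open>z\<close>. There is no sign in
  front of it because the scalar product itself has determinant $(-1)^2 = 1$. Hence the
  cross product of a vector with two orthonormal vectors of equal sign that are orthogonal to it
  has the scalar square of that vector, with the same sign.
\<close>

lemma ip_cross_cross:
  "ip (cross x y z) (cross x y z) =
     ip x x * (ip y y * ip z z - ip y z * ip y z)
     - ip x y * (ip x y * ip z z - ip y z * ip x z)
     + ip x z * (ip x y * ip y z - ip y y * ip x z)"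
  unfolding cross_components ip_def minor3_def vector_4 by algebra

lemma ip_sym: "ip x y = ip y x"
  by (simp add: ip_def mult.commute)

lemma ip_add_right: "ip z (x + y) = ip z x + ip z y"
  by (simp add: ip_def algebra_simps)

lemma ip_diff_right: "ip z (x - y) = ip z x - ip z y"
  by (simp add: ip_def algebra_simps)

lemma ip_minus_right: "ip z (- x) = - ip z x"
  by (simp add: ip_def)

lemma ip_scaleR_right: "ip z (k *\<^sub>R x) = k * ip z x"
  for x :: "real ^ 4"
  by (simp add: ip_def algebra_simps)

lemma ip_scaleR_left: "ip (k *\<^sub>R x) z = k * ip x z"
  for x :: "real ^ 4"
  by (simp add: ip_def algebra_simps)

lemma ip_zero: "ip x 0 = 0" "ip 0 x = 0"
  by (simp_all add: ip_def)

lemma ip_scale_cnj: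
  "ip (k *s z) (cnj_vec (l *s z)) = k * cnj l * ip z (cnj_vec z)"
  by (simp add: ip_def cnj_vec_def algebra_simps)

lemma ip_scale_scale: "ip (k *s z) (l *s z) = k * l * ip z z"
  by (simp add: ip_def algebra_simps)

section \<open>The quadrics\<close>

lemma Re_ip_scale_cnj:
  "Re (ip (k *s z) (cnj_vec (k *s z))) = (cmod k)\<^sup>2 * Re (ip z (cnj_vec z))"
  by (simp add: ip_scale_cnj complex_norm_square[symmetric] flip: of_real_power)

text \<open>
  Two representatives of a point of projective space differ by a nonzero factor \<open>k\<close>, which
  multiplies \<open>ip z z\<close> by \<open>k\<^sup>2\<close> and \<open>ip z (cnj_vec z)\<close> by \<open>\<bar>k\<bar>\<^sup>2\<close>. Membership in a
  quadric can therefore be read off any representative.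
\<close>

lemma cline_eqD:
  assumes "cline z = cline w" "w \<noteq> 0"
  obtains k where "k \<noteq> 0" "w = k *s z"
proof -
  have "w \<in> cline w"
    unfolding cline_def by (metis rangeI vector_smult_lid)
  then obtain k where "w = k *s z"
    using assms(1) unfolding cline_def by auto
  moreover have "k \<noteq> 0"
    using calculation assms(2) by auto
  ultimately show thesis
    using that by blast
qed

lemma cline_mem_Q_pos: "cline z \<in> Q_pos \<longleftrightarrow> ip z z = 0 \<and> 0 < Re (ip z (cnj_vec z))"
proof
  assume "cline z \<in> Q_pos"
  then obtain w where w: "cline z = cline w" "w \<noteq> 0" "ip w w = 0" "0 < Re (ip w (cnj_vec w))"
    unfolding Q_pos_def by blast
  then obtain k where "k \<noteq> 0" "w = k *s z"
    using cline_eqD by blast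
  then show "ip z z = 0 \<and> 0 < Re (ip z (cnj_vec z))"
    using w by (auto simp: Re_ip_scale_cnj ip_scale_scale zero_less_mult_iff)
next
  assume *: "ip z z = 0 \<and> 0 < Re (ip z (cnj_vec z))"
  then have "z \<noteq> 0" by (auto simp: ip_zero)
  with * show "cline z \<in> Q_pos" unfolding Q_pos_def by blast
qed

lemma cline_mem_Q_neg: "cline z \<in> Q_neg \<longleftrightarrow> ip z z = 0 \<and> Re (ip z (cnj_vec z)) < 0"
proof
  assume "cline z \<in> Q_neg"
  then obtain w where w: "cline z = cline w" "w \<noteq> 0" "ip w w = 0" "Re (ip w (cnj_vec w)) < 0"
    unfolding Q_neg_def by blast
  then obtain k where "k \<noteq> 0" "w = k *s z"
    using cline_eqD by blast
  then show "ip z z = 0 \<and> Re (ip z (cnj_vec z)) < 0"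
    using w by (auto simp: Re_ip_scale_cnj ip_scale_scale mult_less_0_iff)
next
  assume *: "ip z z = 0 \<and> Re (ip z (cnj_vec z)) < 0"
  then have "z \<noteq> 0" by (auto simp: ip_zero)
  with * show "cline z \<in> Q_neg" unfolding Q_neg_def by blast
qed

section \<open>The isotropic form along the curve\<close>

lemma ip_cvec_add_i:
  "ip (cvec x + \<i> *s cvec y) (cvec x + \<i> *s cvec y) = Complex (ip x x - ip y y) (2 * ip x y)"
  by (simp add: complex_eq_iff ip_def cvec_def algebra_simps)

lemma ip_cvec_add_i_cnj:
  "ip (cvec x + \<i> *s cvec y) (cnj_vec (cvec x + \<i> *s cvec y)) = of_real (ip x x + ip y y)"
  by (simp add: complex_eq_iff ip_def cvec_def cnj_vec_def algebra_simps)

text \<open>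
  The integrand of the representation formula, as a function of the values of the three
  extended fields.
\<close>

definition bjorling_form :: "complex ^ 4 \<Rightarrow> complex ^ 4 \<Rightarrow> complex ^ 4 \<Rightarrow> complex ^ 4" where
  "bjorling_form x y z = x - \<i> *s ccross x y z"

lemma bjorling_form_cvec:
  "bjorling_form (cvec x) (cvec y) (cvec z) = cvec x + \<i> *s cvec (- cross x y z)"
  unfolding bjorling_form_def ccross_cvec by (simp add: cvec_def vec_eq_iff)

text \<open>
  The cross product \<open>n\<close> of \<open>x\<close>, \<open>a\<close>, \<open>b\<close> is orthogonal to \<open>x\<close> and, by the Gram
  identity, has the same scalar square as \<open>x\<close>. So $x - i n$ is isotropic.
\<close>

lemma bjorling_form_isotropic:
  assumes "ip a a = s" "ip b b = s" "ip a b = 0" "ip x a = 0" "ip x b = 0" "s * s = 1"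
  defines "z \<equiv> bjorling_form (cvec x) (cvec a) (cvec b)"
  shows "ip z z = 0" "Re (ip z (cnj_vec z)) = 2 * ip x x"
    "ip (cross x a b) (cross x a b) = ip x x"
proof -
  show *: "ip (cross x a b) (cross x a b) = ip x x"
    by (simp add: ip_cross_cross assms)
  then have "ip (- cross x a b) (- cross x a b) = ip x x"
    by (simp add: ip_def)
  moreover have "ip x (- cross x a b) = 0"
    by (simp add: ip_minus_right ip_sym[of x] ip_cross_orthogonal)
  ultimately show "ip z z = 0" "Re (ip z (cnj_vec z)) = 2 * ip x x"
    unfolding z_def bjorling_form_cvec ip_cvec_add_i ip_cvec_add_i_cnj
    by (simp_all add: Complex_eq)
qed

lemma ip_nondegenerate_basis:
  assumes "vol4 x y z u \<noteq> 0" "ip x v = 0" "ip y v = 0" "ip z v = 0" "ip u v = 0"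
  shows "v = 0"
proof -
  define M :: "real ^ 4 ^ 4" where "M = vector [x, y, z, u]"
  define v' :: "real ^ 4" where "v' = vector [- v $ 1, - v $ 2, v $ 3, v $ 4]"
  have "invertible M"
    using assms(1) by (simp add: M_def vol4_def invertible_det_nz)
  moreover have "M *v v' = 0"
    using assms(2-5)
    by (simp add: vec_eq_iff forall_4 matrix_vector_mult_def M_def v'_def vector_4 sum_4 ip_def)
  ultimately have "v' = 0"
    by (metis invertible_def matrix_left_invertible_ker)
  then show "v = 0"
    by (simp add: vec_eq_iff forall_4 v'_def vector_4)
qed

text \<open>
  The vectors \<open>x\<close>, \<open>a\<close>, \<open>b\<close> and the cross product \<open>n\<close> form a basis, because their
  volume is \<open>ip n n = ip x x\<close>. Subtracting from a vector orthogonal to \<open>x\<close> and \<open>n\<close> its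
  components along \<open>a\<close> and \<open>b\<close> leaves a vector orthogonal to this basis, hence zero.
\<close>

lemma orthogonal_complement_cross:
  assumes "ip a a = s" "ip b b = s" "ip a b = 0" "ip x a = 0" "ip x b = 0" "s * s = 1" "ip x x \<noteq> 0"
  shows "{n. ip x n = 0 \<and> ip (cross x a b) n = 0} = span {a, b}"
proof (intro equalityI subsetI)
  fix n assume n: "n \<in> {n. ip x n = 0 \<and> ip (cross x a b) n = 0}"
  define m where "m = n - (s * ip a n) *\<^sub>R a - (s * ip b n) *\<^sub>R b"
  have ba: "ip b a = 0" and ca: "ip (cross x a b) a = 0" "ip (cross x a b) b = 0"
    using assms(3) by (auto simp: ip_sym[of b] ip_cross_orthogonal)
  have ss: "s * (s * t) = t" for t
    using assms(6) by (metis mult.assoc mult.left_neutral)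
  have "m = 0"
  proof (rule ip_nondegenerate_basis)
    have "vol4 x a b (cross x a b) = ip x x"
      unfolding vol4_eq_ip_cross by (rule bjorling_form_isotropic[OF assms(1-6)])
    then show "vol4 x a b (cross x a b) \<noteq> 0"
      using assms(7) by simp
  qed (use n assms(1-5) ba ca ss in \<open>auto simp: m_def ip_diff_right ip_scaleR_right mult.commute mult.left_commute\<close>)
  then have "n = (s * ip a n) *\<^sub>R a + (s * ip b n) *\<^sub>R b"
    by (simp add: m_def algebra_simps)
  then show "n \<in> span {a, b}"
    by (metis insertI1 insertI2 span_add span_base span_scale)
next
  fix n assume "n \<in> span {a, b}"
  then obtain k l where "n = k *\<^sub>R a + l *\<^sub>R b"
    by (auto simp: span_insert span_singleton algebra_simps eq_diff_eq)
  then show "n \<in> {n. ip x n = 0 \<and> ip (cross x a b) n = 0}"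
    using assms by (simp add: ip_add_right ip_scaleR_right ip_cross_orthogonal)
qed

section \<open>Conformal surfaces\<close>

lemma ip_Re_vec: "ip (Re_vec u) (Re_vec v) = Re (ip u v + ip u (cnj_vec v)) / 2"
  by (simp add: ip_def Re_vec_def cnj_vec_def field_simps)

text \<open>
  For a map with differential $X \mapsto \mathrm{Re}(X z)$, isotropy of \<open>z\<close> is conformality,
  and the conformal factor is half the Hermitian square of \<open>z\<close>. Indeed
  $2\,\mathrm{Re}\,p\,\mathrm{Re}\,q = \mathrm{Re}(pq + p\bar q)$ splits the induced metric
  into a term in \<open>ip z z\<close> and a term in \<open>ip z (cnj_vec z)\<close>.
\<close>

lemma isotropic_conformal:
  assumes "ip z z = 0"
  shows "ip (Re_vec (X *s z)) (Re_vec (Y *s z)) = Re (ip z (cnj_vec z)) / 2 * (X \<bullet> Y)"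
  using Im_ip_cnj_vec[of z] assms
  unfolding ip_Re_vec ip_scale_scale ip_scale_cnj
  by (simp add: inner_complex_def algebra_simps)

text \<open>
  A nonzero conformal factor makes the tangent plane nondegenerate, so orthogonal projection
  to it exists and the normal part is determined.
\<close>

lemma conformal_normal_decomposition:
  fixes f :: "complex \<Rightarrow> real ^ 4"
  assumes lin: "linear (frechet_derivative f (at p))" and l: "l \<noteq> 0"
    and conf: "\<And>X Y. induced_metric f p X Y = l * (X \<bullet> Y)"
  shows "\<exists>!n. n \<in> normal_plane f p \<and> x - n \<in> tangent_plane f p"
proof -
  let ?D = "frechet_derivative f (at p)"
  have ip_D: "ip (?D X) (?D Y) = l * (X \<bullet> Y)" for X Y
    using conf by (simp add: induced_metric_def)
  \<comment> \<open>the coordinates of the projection of \<open>x\<close> in the basis of coordinate vectors\<close>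
  define Z where "Z = Complex (ip (?D 1) x / l) (ip (?D \<i>) x / l)"
  have "ip (?D Y) (x - ?D Z) = 0" for Y
  proof -
    have "?D Y = ?D (Re Y *\<^sub>R 1 + Im Y *\<^sub>R \<i>)"
      by (rule arg_cong) (simp add: complex_eq_iff)
    also have "\<dots> = Re Y *\<^sub>R ?D 1 + Im Y *\<^sub>R ?D \<i>"
      by (simp only: linear_add[OF lin] linear_cmul[OF lin])
    finally have "ip (?D Y) x = l * (Y \<bullet> Z)"
      using l by (simp add: ip_add_left ip_scaleR_left Z_def inner_complex_def field_simps)
    then show ?thesis
      by (simp add: ip_diff_right ip_D)
  qed
  then have ex: "x - ?D Z \<in> normal_plane f p \<and> x - (x - ?D Z) \<in> tangent_plane f p"
    by (auto simp: normal_plane_def tangent_plane_def)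
  have unique: "n = m"
    if n: "n \<in> normal_plane f p" "x - n \<in> tangent_plane f p"
      and m: "m \<in> normal_plane f p" "x - m \<in> tangent_plane f p" for n m
  proof -
    obtain X Y where XY: "x - n = ?D X" "x - m = ?D Y"
      using n m unfolding tangent_plane_def by blast
    have "n - m = (x - m) - (x - n)"
      by simp
    also have "\<dots> = ?D (Y - X)"
      unfolding XY by (simp only: linear_diff[OF lin])
    finally have nm: "n - m = ?D (Y - X)" .
    have "ip (?D (Y - X)) (n - m) = 0"
      using n m by (simp add: normal_plane_def tangent_plane_def ip_diff_right)
    then have "Y - X = 0"
      using l unfolding nm ip_D by simp
    then show "n = m"
      using nm linear_0[OF lin] by simp
  qed
  show ?thesis
    using ex by (rule ex1I) (use ex unique in \<open>simp only:\<close>)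
qed

lemma normal_part_minus:
  fixes f :: "complex \<Rightarrow> real ^ 4"
  assumes lin: "linear (frechet_derivative f (at p))" and l: "l \<noteq> 0"
    and conf: "\<And>X Y. induced_metric f p X Y = l * (X \<bullet> Y)"
  shows "normal_part f p (- x) = - normal_part f p x"
proof -
  note ex1 = conformal_normal_decomposition[OF assms]
  have "normal_part f p x \<in> normal_plane f p \<and> x - normal_part f p x \<in> tangent_plane f p"
    unfolding normal_part_def by (rule theI'[OF ex1])
  then have "- normal_part f p x \<in> normal_plane f p"
      and t: "x - normal_part f p x \<in> tangent_plane f p"
    by (auto simp: normal_plane_def ip_minus_right)
  moreover have "- (x - normal_part f p x) \<in> tangent_plane f p"
  proof -
    obtain W where "x - normal_part f p x = frechet_derivative f (at p) W"
      using t unfolding tangent_plane_def by blast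
    then have "- (x - normal_part f p x) = frechet_derivative f (at p) (- W)"
      by (simp only: linear_neg[OF lin])
    then show ?thesis
      unfolding tangent_plane_def by simp
  qed
  ultimately show ?thesis
    unfolding normal_part_def[of f p "- x"]
    by (intro the1_equality[OF ex1] conjI) simp_all
qed

text \<open>
  In conformal coordinates the trace of the second fundamental form is a multiple of the sum
  of the normal parts of \<open>f\<^sub>u\<^sub>u\<close> and \<open>f\<^sub>v\<^sub>v\<close>, which cancel for harmonic maps.
\<close>

lemma mean_curvature_conformal_harmonic:
  fixes f :: "complex \<Rightarrow> real ^ 4"
  assumes lin: "linear (frechet_derivative f (at p))" and l: "l \<noteq> 0"
    and conf: "\<And>X Y. induced_metric f p X Y = l * (X \<bullet> Y)"
    and harmonic: "d_v (d_v f) p = - d_u (d_u f) p"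
  shows "mean_curvature f p = 0"
  unfolding mean_curvature_def Let_def conf harmonic normal_part_minus[OF lin l conf]
  by (simp add: inner_complex_def)

section \<open>Real parts of holomorphic maps\<close>

lemma has_derivative_Re_vec:
  assumes "\<And>i. ((\<lambda>w. h w $ i) has_field_derivative h' $ i) (at p)"
  shows "((\<lambda>w. a + Re_vec (h w)) has_derivative (\<lambda>X. Re_vec (X *s h'))) (at p)"
proof -
  have "((\<lambda>w. (a + Re_vec (h w)) \<bullet> b) has_derivative (\<lambda>X. Re_vec (X *s h') \<bullet> b)) (at p)"
    if "b \<in> Basis" for b :: "real ^ 4"
  proof -
    obtain i where b: "b = axis i 1"
      using \<open>b \<in> Basis\<close> by (auto simp: Basis_vec_def)
    have "((\<lambda>w. a $ i + Re (h w $ i)) has_derivative (\<lambda>X. 0 + Re (h' $ i * X))) (at p)"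
      using assms[of i, unfolded has_field_derivative_def]
      by (intro has_derivative_add has_derivative_const bounded_linear.has_derivative[OF bounded_linear_Re])
    then show ?thesis
      unfolding b cart_eq_inner_axis[symmetric] by (simp add: Re_vec_def mult.commute)
  qed
  then show ?thesis
    by (subst has_derivative_componentwise_within) auto
qed

definition cderiv :: "(complex \<Rightarrow> complex ^ 4) \<Rightarrow> complex \<Rightarrow> complex ^ 4" where
  "cderiv h w = (\<chi> i. deriv (\<lambda>z. h z $ i) w)"

text \<open>
  Agreement with the real part of \<open>h\<close> is assumed on the open set alone, so that the lemma
  applies again to the partial derivatives of \<open>g\<close>, for which a formula is known only there.
\<close>

lemma has_derivative_Re_vec_holomorphic:
  assumes M: "open M" "p \<in> M" and h: "\<And>i. (\<lambda>w. h w $ i) holomorphic_on M"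
    and g: "\<And>w. w \<in> M \<Longrightarrow> g w = a + Re_vec (h w)"
  shows "(g has_derivative (\<lambda>X. Re_vec (X *s cderiv h p))) (at p)"
proof (rule has_derivative_transform_within_open[OF _ M])
  show "((\<lambda>w. a + Re_vec (h w)) has_derivative (\<lambda>X. Re_vec (X *s cderiv h p))) (at p)"
    using holomorphic_derivI[OF h M] by (intro has_derivative_Re_vec) (simp add: cderiv_def)
qed (simp add: g)

lemma Re_vec_holomorphic_partials:
  assumes "open M" "p \<in> M" "\<And>i. (\<lambda>w. h w $ i) holomorphic_on M"
    and "\<And>w. w \<in> M \<Longrightarrow> g w = a + Re_vec (h w)"
  shows "d_u g p = Re_vec (cderiv h p)" "d_v g p = Re_vec (\<i> *s cderiv h p)"
    "d_w g p = (1/2) *s cderiv h p"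
proof -
  have D: "frechet_derivative g (at p) = (\<lambda>X. Re_vec (X *s cderiv h p))"
    using has_derivative_Re_vec_holomorphic[OF assms] by (rule frechet_derivative_at[symmetric])
  show u: "d_u g p = Re_vec (cderiv h p)" and v: "d_v g p = Re_vec (\<i> *s cderiv h p)"
    by (simp_all add: d_u_def d_v_def D)
  show "d_w g p = (1/2) *s cderiv h p"
    unfolding d_w_def u v by (simp add: vec_eq_iff complex_eq_iff cvec_def Re_vec_def)
qed

lemma holomorphic_on_cderiv:
  assumes "open M" "\<And>i. (\<lambda>w. h w $ i) holomorphic_on M"
  shows "(\<lambda>w. cderiv h w $ i) holomorphic_on M"
  using holomorphic_deriv[OF assms(2,1)] by (simp add: cderiv_def)

text \<open>
  The class of real parts of holomorphic maps is closed under both partial derivatives: they are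
  the real parts of \<open>h'\<close> and of \<open>\<i> h'\<close>.
\<close>

lemma Ck_on_Re_vec_holomorphic:
  assumes M: "open M" and h: "\<And>i. (\<lambda>w. h w $ i) holomorphic_on M"
    and g: "\<And>w. w \<in> M \<Longrightarrow> g w = a + Re_vec (h w)"
  shows "Ck_on k M g"
  using h g
proof (induction k arbitrary: a g h)
  case 0
  have "isCont g w" if "w \<in> M" for w
    by (rule has_derivative_continuous[OF has_derivative_Re_vec_holomorphic[OF M that 0]])
  then have "continuous_on M g"
    by (simp add: continuous_at_imp_continuous_on)
  then show ?case by simp
next
  case (Suc k)
  note hol = holomorphic_on_cderiv[OF M Suc.prems(1)]
  have "g differentiable (at p)" if "p \<in> M" for p
    using has_derivative_Re_vec_holomorphic[OF M that Suc.prems] by (auto simp: differentiable_def)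
  moreover have "Ck_on k M (d_u g)"
    by (rule Suc.IH[OF hol, where a=0]) (simp add: Re_vec_holomorphic_partials[OF M _ Suc.prems])
  moreover have "Ck_on k M (d_v g)"
  proof (rule Suc.IH[where a=0])
    show "(\<lambda>w. (\<i> *s cderiv h w) $ i) holomorphic_on M" for i
      using hol by (auto intro!: holomorphic_intros)
  qed (simp add: Re_vec_holomorphic_partials[OF M _ Suc.prems])
  ultimately show ?case by simp
qed

lemma Re_vec_holomorphic_harmonic:
  assumes M: "open M" "p \<in> M" and h: "\<And>i. (\<lambda>w. h w $ i) holomorphic_on M"
    and g: "\<And>w. w \<in> M \<Longrightarrow> g w = a + Re_vec (h w)"
  shows "d_v (d_v g) p = - d_u (d_u g) p"
proof -
  note hol = holomorphic_on_cderiv[OF M(1) h]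
  have hol': "(\<lambda>w. (\<i> *s cderiv h w) $ i) holomorphic_on M" for i
    using hol by (auto intro!: holomorphic_intros)
  have "d_u (d_u g) p = Re_vec (cderiv (cderiv h) p)"
    by (rule Re_vec_holomorphic_partials(1)[OF M hol, where a=0])
      (simp add: Re_vec_holomorphic_partials[OF M(1) _ h g])
  moreover have "d_v (d_v g) p = Re_vec (\<i> *s cderiv (\<lambda>w. \<i> *s cderiv h w) p)"
    by (rule Re_vec_holomorphic_partials(2)[OF M hol', where a=0])
      (simp add: Re_vec_holomorphic_partials[OF M(1) _ h g])
  moreover have "cderiv (\<lambda>w. \<i> *s cderiv h w) p = \<i> *s cderiv (cderiv h) p"
  proof -
    have "(\<lambda>w. cderiv h w $ i) field_differentiable at p" for i
      by (rule holomorphic_on_imp_differentiable_at[OF hol M])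
    then show ?thesis
      by (simp add: vec_eq_iff cderiv_def[of "\<lambda>w. \<i> *s cderiv h w"] cderiv_def[of "cderiv h"])
  qed
  ultimately show ?thesis
    by (simp add: vec_eq_iff Re_vec_def)
qed

section \<open>Holomorphic extension of real analytic fields\<close>

text \<open>
  The identity theorem for zeros on the real line: as \<open>I\<close> and \<open>M\<close> are open, one common point
  \<open>t\<close> is already an accumulation point of common points.
\<close>

lemma holomorphic_zero_on_reals:
  fixes I :: "real set"
  assumes "f holomorphic_on M" "open M" "connected M" "open I"
    and t: "t \<in> I" "complex_of_real t \<in> M"
    and zero: "\<And>t. t \<in> I \<Longrightarrow> complex_of_real t \<in> M \<Longrightarrow> f (complex_of_real t) = 0" and "w \<in> M"
  shows "f w = 0"
proof (rule analytic_continuation[of f M "complex_of_real ` (I \<inter> complex_of_real -` M)" "of_real t"])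
  have "open (I \<inter> complex_of_real -` M)"
    using assms(2,4) by (intro open_Int open_vimage continuous_intros)
  then obtain d where d: "d > 0" "\<And>x. \<bar>x - t\<bar> < d \<Longrightarrow> x \<in> I \<inter> complex_of_real -` M"
    using t unfolding open_dist dist_real_def by blast
  show "complex_of_real t islimpt complex_of_real ` (I \<inter> complex_of_real -` M)"
    unfolding islimpt_approachable
  proof (intro allI impI)
    fix e :: real assume "e > 0"
    let ?x = "t + min d e / 2"
    have "0 < min d e / 2" "min d e / 2 < d" "min d e / 2 < e"
      using d(1) \<open>e > 0\<close> by auto
    then have "?x \<in> I \<inter> complex_of_real -` M" "?x \<noteq> t" "\<bar>?x - t\<bar> < e"
      by (simp_all only: d(2) add_diff_cancel_left' abs_of_pos)
    then show "\<exists>y\<in>complex_of_real ` (I \<inter> complex_of_real -` M). y \<noteq> complex_of_real t \<and> dist y (complex_of_real t) < e"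
      by (intro bexI[of _ "complex_of_real ?x"]) (auto simp: dist_of_real dist_real_def simp del: of_real_add)
  qed
qed (use assms in auto)

lemma holo_extension_unique:
  assumes "holo_extension (I \<inter> complex_of_real -` M) g M h" "holo_extension (I \<inter> complex_of_real -` M) g M h'"
    and M: "open M" "connected M" "open I" and t: "I \<inter> complex_of_real -` M \<noteq> {}" and "w \<in> M"
  shows "h w = h' w"
proof -
  obtain t where t: "t \<in> I" "complex_of_real t \<in> M"
    using t by auto
  have "h w $ i - h' w $ i = 0" for i
  proof (rule holomorphic_zero_on_reals[OF _ M t _ \<open>w \<in> M\<close>])
    show "(\<lambda>w. h w $ i - h' w $ i) holomorphic_on M"
      using assms(1,2) by (auto simp: holo_extension_def intro!: holomorphic_intros)
  qed (use assms(1,2) in \<open>simp add: holo_extension_def\<close>)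
  then show ?thesis
    by (simp add: vec_eq_iff)
qed

text \<open>
  A power series that converges at the real point \<open>t0 + \<rho>\<close> converges in the complex disc of
  radius \<open>\<rho>\<close>.
\<close>

lemma real_analytic_local_extension:
  fixes g :: "real \<Rightarrow> real ^ 4"
  assumes g: "real_analytic_on g I" and I: "open I" "t0 \<in> I"
  obtains \<rho> h where "\<rho> > 0" "\<And>t. \<bar>t - t0\<bar> < \<rho> \<Longrightarrow> t \<in> I"
    "holo_extension (I \<inter> complex_of_real -` ball (complex_of_real t0) \<rho>) g (ball (complex_of_real t0) \<rho>) h"
proof -
  obtain e a where e: "e > 0" and a: "\<And>t. t \<in> I \<Longrightarrow> \<bar>t - t0\<bar> < e \<Longrightarrow> (\<lambda>n. (t - t0) ^ n *\<^sub>R a n) sums g t"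
    using g I unfolding real_analytic_on_def by blast
  obtain d where d: "d > 0" "\<And>t. \<bar>t - t0\<bar> < d \<Longrightarrow> t \<in> I"
    using I unfolding open_dist dist_real_def by blast
  \<comment> \<open>half of the radius, so that the series still converges at the boundary point \<open>t0 + \<rho>\<close>\<close>
  define \<rho> where "\<rho> = min d e / 2"
  have \<rho>: "0 < \<rho>" "\<rho> < d" "\<rho> < e"
    using d e by (auto simp: \<rho>_def)
  have sums: "(\<lambda>n. a n $ i * (t - t0) ^ n) sums (g t $ i)" if "\<bar>t - t0\<bar> \<le> \<rho>" for t i
    using bounded_linear.sums[OF bounded_linear_vec_nth, OF a[OF d(2)], of t i] that \<rho>
    by (simp add: mult.commute)
  define h where "h w = (\<chi> i. \<Sum>n. complex_of_real (a n $ i) * (w - of_real t0) ^ n)" for w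
  have hs: "(\<lambda>n. complex_of_real (a n $ i) * (w - of_real t0) ^ n) sums (h w $ i)"
    if "w \<in> ball (of_real t0) \<rho>" for w i
  proof -
    have "summable (\<lambda>n. complex_of_real (a n $ i) * (of_real \<rho>) ^ n)"
      using sums_of_real[OF sums[of "t0 + \<rho>" i], where 'a=complex] \<rho> by (auto simp: summable_def)
    then have "summable (\<lambda>n. complex_of_real (a n $ i) * (w - of_real t0) ^ n)"
      by (rule powser_inside) (use that \<rho> in \<open>simp add: dist_norm norm_minus_commute\<close>)
    then show ?thesis
      by (simp add: h_def summable_sums)
  qed
  have "holo_extension (I \<inter> complex_of_real -` ball (complex_of_real t0) \<rho>) g (ball (complex_of_real t0) \<rho>) h"
    unfolding holo_extension_def
  proof (intro conjI allI ballI)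
    show "(\<lambda>w. h w $ i) holomorphic_on ball (complex_of_real t0) \<rho>" for i
      using hs by (rule power_series_holomorphic)
    show "h (complex_of_real t) = cvec (g t)"
      if "t \<in> I \<inter> complex_of_real -` ball (complex_of_real t0) \<rho>" for t
    proof -
      have t: "\<bar>t - t0\<bar> < \<rho>" "complex_of_real t \<in> ball (complex_of_real t0) \<rho>"
        using that by (auto simp: dist_of_real dist_real_def)
      have "h (complex_of_real t) $ i = of_real (g t $ i)" for i
        using sums_unique2[OF hs[OF t(2), of i]] sums_of_real[OF sums[of t i], where 'a=complex] t by simp
      then show ?thesis
        by (simp add: vec_eq_iff cvec_def)
    qed
  qed
  then show thesis
    using that \<rho> d by force
qed

text \<open>
  The complex derivative of an extension of \<open>c\<close>, computed along the real axis, is the real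
  derivative.
\<close>

lemma holo_extension_vel:
  assumes h: "holo_extension (I \<inter> complex_of_real -` U) c U h" and U: "open U" "open I"
    and diff: "\<And>t. t \<in> I \<Longrightarrow> c differentiable (at t)"
  shows "holo_extension (I \<inter> complex_of_real -` U) (vel c) U (cderiv h)"
proof -
  have hol: "(\<lambda>w. h w $ i) holomorphic_on U" and eq: "\<And>t. t \<in> I \<Longrightarrow> complex_of_real t \<in> U \<Longrightarrow> h (of_real t) = cvec (c t)" for i
    using h by (auto simp: holo_extension_def)
  have "cderiv h (of_real t) $ i = cvec (vel c t) $ i" if t: "t \<in> I" "complex_of_real t \<in> U" for t i
  proof -
    let ?J = "I \<inter> complex_of_real -` U"
    have J: "open ?J" "t \<in> ?J"
      using t U by (auto intro!: open_Int open_vimage continuous_intros)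
    have "(c has_vector_derivative vel c t) (at t)"
      using diff[OF t(1)] by (simp add: vel_def vector_derivative_works)
    then have "((\<lambda>t. c t $ i) has_vector_derivative vel c t $ i) (at t)"
      using bounded_linear.has_vector_derivative[OF bounded_linear_vec_nth] by blast
    then have 1: "((\<lambda>t. complex_of_real (c t $ i)) has_vector_derivative of_real (vel c t $ i)) (at t)"
      by (rule bounded_linear.has_vector_derivative[OF bounded_linear_of_real])
    have "((\<lambda>t. h (of_real t) $ i) has_vector_derivative deriv (\<lambda>w. h w $ i) (of_real t)) (at t)"
      using has_vector_derivative_real_field[OF holomorphic_derivI[OF hol U(1) t(2)]] by simp
    then have "((\<lambda>t. complex_of_real (c t $ i)) has_vector_derivative deriv (\<lambda>w. h w $ i) (of_real t)) (at t)"
      by (rule has_vector_derivative_transform_within_open[OF _ J]) (auto simp: eq cvec_def)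
    with 1 show ?thesis
      by (auto simp: cderiv_def cvec_def dest: vector_derivative_unique_at)
  qed
  then show ?thesis
    using holomorphic_on_cderiv[OF U(1) hol] by (auto simp: holo_extension_def vec_eq_iff)
qed

section \<open>Primitives and simply connected domains\<close>

text \<open>
  On a simply connected domain the integral from 0 is the value of the primitive that vanishes
  at 0. The converse implication in the second conclusion needs some path from 0 to \<open>w\<close>,
  which exists by connectedness; it identifies any value of the integral.
\<close>

lemma holomorphic_potential:
  assumes M: "open M" "simply_connected M" "0 \<in> M" and \<phi>: "\<And>i. (\<lambda>w. \<phi> w $ i) holomorphic_on M"
  obtains F where "\<And>w i. w \<in> M \<Longrightarrow> ((\<lambda>w. F w $ i) has_field_derivative \<phi> w $ i) (at w)"
    "\<And>w J. w \<in> M \<Longrightarrow> has_integral_from_to \<phi> J M 0 w \<longleftrightarrow> J = F w"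
    "F 0 = 0"
proof -
  have "\<exists>G. \<forall>w\<in>M. (G has_field_derivative \<phi> w $ i) (at w)" for i
    using simply_connected_eq_global_primitive[OF M(1)] M(2) \<phi> by blast
  then obtain G where G: "\<And>w i. w \<in> M \<Longrightarrow> (G i has_field_derivative \<phi> w $ i) (at w)"
    by metis
  define F where "F w = (\<chi> i. G i w - G i 0)" for w
  have F: "((\<lambda>w. F w $ i) has_field_derivative \<phi> w $ i) (at w)" if "w \<in> M" for w i
    using DERIV_diff[OF G[OF that] DERIV_const] by (simp add: F_def)
  have F0: "F 0 = 0"
    by (simp add: F_def vec_eq_iff)
  have int: "((\<lambda>\<xi>. \<phi> \<xi> $ i) has_contour_integral F w $ i) \<gamma>"
    if "valid_path \<gamma>" "path_image \<gamma> \<subseteq> M" "pathstart \<gamma> = 0" "pathfinish \<gamma> = w" for \<gamma> i w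
    using contour_integral_primitive[of M "\<lambda>w. F w $ i" "\<lambda>w. \<phi> w $ i" \<gamma>] F F0 that
    by (auto intro: has_field_derivative_at_within)
  have "J = F w" if J: "has_integral_from_to \<phi> J M 0 w" and w: "w \<in> M" for J w
  proof -
    have "connected M"
      using M(2) by (rule simply_connected_imp_connected)
    then obtain \<gamma> where "polynomial_function \<gamma>" "path_image \<gamma> \<subseteq> M" "pathstart \<gamma> = 0" "pathfinish \<gamma> = w"
      using connected_open_polynomial_connected[OF M(1) _ M(3) w] by blast
    then have \<gamma>: "valid_path \<gamma>" "path_image \<gamma> \<subseteq> M" "pathstart \<gamma> = 0" "pathfinish \<gamma> = w"
      by (auto intro: valid_path_polynomial_function)
    then have "((\<lambda>\<xi>. \<phi> \<xi> $ i) has_contour_integral J $ i) \<gamma>" for i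
      using J by (simp add: has_integral_from_to_def)
    then have "J $ i = F w $ i" for i
      by (rule has_contour_integral_unique[OF _ int[OF \<gamma>]])
    then show ?thesis
      by (simp add: vec_eq_iff)
  qed
  moreover have "has_integral_from_to \<phi> (F w) M 0 w" for w
    unfolding has_integral_from_to_def using int by blast
  ultimately show thesis
    using that[OF F] F0 by blast
qed

text \<open>
  A loop is moved vertically into the real axis, where it contracts by convexity.
\<close>

lemma simply_connected_vertically_starlike:
  assumes seg: "\<And>w. w \<in> S \<Longrightarrow> closed_segment w (complex_of_real (Re w)) \<subseteq> S"
    and conv: "convex (S \<inter> \<real>)"
  shows "simply_connected S"
  unfolding simply_connected_eq_contractible_loop_any
proof (intro allI impI)
  fix p a
  assume p: "path p \<and> path_image p \<subseteq> S \<and> pathfinish p = pathstart p \<and> a \<in> S"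
  let ?\<pi> = "\<lambda>w. complex_of_real (Re w)"
  have \<pi>: "?\<pi> w \<in> S \<inter> \<real>" if "w \<in> S" for w
    using seg[OF that] by auto
  have path: "path (?\<pi> \<circ> p)"
    using p by (intro path_continuous_image) (auto intro!: continuous_intros)
  have 1: "homotopic_loops S p (?\<pi> \<circ> p)"
  proof (rule homotopic_loops_linear)
    fix t :: real assume "t \<in> {0..1}"
    then have "p t \<in> S"
      using p by (auto simp: path_image_def)
    then show "closed_segment (p t) ((?\<pi> \<circ> p) t) \<subseteq> S"
      using seg by simp
  qed (use p path in \<open>auto simp: pathstart_def pathfinish_def\<close>)
  have 2: "homotopic_loops S (?\<pi> \<circ> p) (linepath (?\<pi> a) (?\<pi> a))"
  proof (rule homotopic_loops_subset[of "S \<inter> \<real>"])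
    have "path_image (?\<pi> \<circ> p) \<subseteq> S \<inter> \<real>"
      using p \<pi> by (auto simp: path_image_def)
    then show "homotopic_loops (S \<inter> \<real>) (?\<pi> \<circ> p) (linepath (?\<pi> a) (?\<pi> a))"
      using convex_imp_simply_connected[OF conv] path p \<pi>[of a]
      unfolding simply_connected_eq_contractible_loop_any
      by (auto simp: pathstart_def pathfinish_def)
  qed simp
  have 3: "homotopic_loops S (linepath (?\<pi> a) (?\<pi> a)) (linepath a a)"
  proof (rule homotopic_loops_linear)
    show "closed_segment (linepath (?\<pi> a) (?\<pi> a) t) (linepath a a t) \<subseteq> S" for t
      using seg[of a] p by (simp add: closed_segment_commute linepath_refl)
  qed auto
  show "homotopic_loops S p (linepath a a)"
    using homotopic_loops_trans[OF homotopic_loops_trans[OF 1 2] 3] .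
qed

text \<open>
  A loop is compact, so it lies in a single member of the chain and contracts there.
\<close>

lemma simply_connected_Union_chain:
  fixes C :: "complex set set"
  assumes "subset.chain A C" "\<And>U. U \<in> C \<Longrightarrow> open U" "\<And>U. U \<in> C \<Longrightarrow> simply_connected U"
  shows "simply_connected (\<Union>C)"
  unfolding simply_connected_eq_contractible_loop_any
proof (intro allI impI)
  fix p a
  assume p: "path p \<and> path_image p \<subseteq> \<Union>C \<and> pathfinish p = pathstart p \<and> a \<in> \<Union>C"
  have "compact (insert a (path_image p))"
    using p by (simp add: compact_path_image)
  then obtain D where D: "finite D" "D \<subseteq> C" "insert a (path_image p) \<subseteq> \<Union>D"
    by (rule compactE[where \<T> = C]) (use p assms(2) in auto)
  have "C \<noteq> {}" using p by blast
  have "\<exists>U\<in>C. \<Union>D \<subseteq> U"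
    using D(1,2)
  proof (induction D)
    case (insert V D)
    then obtain U where U: "U \<in> C" "\<Union>D \<subseteq> U"
      by auto
    then have "U \<subseteq> V \<or> V \<subseteq> U"
      using assms(1) insert.prems unfolding subset.chain_def by blast
    then show ?case
      using U insert.prems by auto
  qed (use \<open>C \<noteq> {}\<close> in blast)
  then obtain U where "U \<in> C" "insert a (path_image p) \<subseteq> U"
    using D(3) by blast
  then have "homotopic_loops U p (linepath a a)"
    using assms(3) p unfolding simply_connected_eq_contractible_loop_any by blast
  then show "homotopic_loops (\<Union>C) p (linepath a a)"
    using \<open>U \<in> C\<close> by (meson Union_upper homotopic_loops_subset)
qed

lemma holo_extension_subset:
  assumes "holo_extension (I \<inter> complex_of_real -` U) g U h" "W \<subseteq> U"
  shows "holo_extension (I \<inter> complex_of_real -` W) g W h"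
  using assms by (auto simp: holo_extension_def intro: holomorphic_on_subset)

section \<open>Gluing of extensions\<close>

text \<open>
  On a connected overlap that meets \<open>I\<close> two extensions agree by the identity theorem. The
  conclusion keeps the values on each member, so that pointwise conditions transfer to the
  glued map.
\<close>

lemma holo_extension_glue:
  assumes I: "open I"
    and U: "\<And>U. U \<in> S \<Longrightarrow> open U \<and> holo_extension (I \<inter> complex_of_real -` U) g U (h U)"
    and overlap: "\<And>U V w. U \<in> S \<Longrightarrow> V \<in> S \<Longrightarrow> w \<in> U \<inter> V \<Longrightarrow>
      \<exists>W. open W \<and> connected W \<and> I \<inter> complex_of_real -` W \<noteq> {} \<and> w \<in> W \<and> W \<subseteq> U \<inter> V"
  obtains H where "holo_extension (I \<inter> complex_of_real -` \<Union>S) g (\<Union>S) H"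
    "\<And>U w. U \<in> S \<Longrightarrow> w \<in> U \<Longrightarrow> H w = h U w"
proof -
  have agree: "h U w = h V w" if mem: "U \<in> S" "V \<in> S" "w \<in> U" "w \<in> V" for U V w
  proof -
    obtain W where W: "open W" "connected W" "I \<inter> complex_of_real -` W \<noteq> {}" "w \<in> W" "W \<subseteq> U \<inter> V"
      using overlap[OF mem(1,2) IntI[OF mem(3,4)]] by blast
    have "W \<subseteq> U" "W \<subseteq> V"
      using W(5) by auto
    then have "holo_extension (I \<inter> complex_of_real -` W) g W (h U)"
      "holo_extension (I \<inter> complex_of_real -` W) g W (h V)"
      using U mem holo_extension_subset by blast+
    then show ?thesis
      by (rule holo_extension_unique) (use I W in auto)
  qed
  define H where "H w = h (SOME U. U \<in> S \<and> w \<in> U) w" for w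
  have H: "H w = h U w" if "U \<in> S" "w \<in> U" for U w
  proof -
    have "(SOME U. U \<in> S \<and> w \<in> U) \<in> S \<and> w \<in> (SOME U. U \<in> S \<and> w \<in> U)"
      by (rule someI[where x = U]) (use that in simp)
    then show ?thesis
      unfolding H_def using agree that by blast
  qed
  have "(\<lambda>w. H w $ i) holomorphic_on (\<Union>U\<in>S. U)" for i
  proof (rule holomorphic_on_UN_open)
    fix U assume "U \<in> S"
    then have "(\<lambda>w. h U w $ i) holomorphic_on U"
      using U by (simp add: holo_extension_def)
    then show "(\<lambda>w. H w $ i) holomorphic_on U"
      by (rule holomorphic_transform) (simp add: H[OF \<open>U \<in> S\<close>])
  qed (use U in auto)
  moreover have "H (complex_of_real t) = cvec (g t)" if "t \<in> I" "complex_of_real t \<in> U" "U \<in> S" for t U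
    using U[OF that(3)] that H[OF that(3,2)] by (simp add: holo_extension_def)
  ultimately have "holo_extension (I \<inter> complex_of_real -` \<Union>S) g (\<Union>S) H"
    by (auto simp: holo_extension_def)
  then show thesis
    using that H by blast
qed

lemma holomorphic_on_bjorling_form:
  assumes "\<And>i. (\<lambda>w. x w $ i) holomorphic_on S" "\<And>i. (\<lambda>w. y w $ i) holomorphic_on S"
    "\<And>i. (\<lambda>w. z w $ i) holomorphic_on S"
  shows "(\<lambda>w. bjorling_form (x w) (y w) (z w) $ i) holomorphic_on S"
  unfolding bjorling_form_def ccross_def vector_minus_component vector_smult_component sum_component
  by (intro holomorphic_intros assms)

section \<open>Local solutions and their unions\<close>

text \<open>
  Both causal types are treated at once: \<open>s\<close> is the sign of the scalar square of the velocity
  and \<open>- s\<close> that of the normal fields \<open>A\<close> and \<open>B\<close>. The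
  quadric \<open>Q\<close> is \<open>Q_pos\<close> for \<open>s = 1\<close> and \<open>Q_neg\<close> for \<open>s = - 1\<close>.
\<close>

locale bjorling_data =
  fixes s r :: real and Q :: "(complex ^ 4) set set" and I :: "real set"
    and c A B :: "real \<Rightarrow> real ^ 4"
  assumes r_pos: "0 < r" and I_eq: "I = {-r<..<r}"
    and analytic: "real_analytic_on c I" "real_analytic_on A I" "real_analytic_on B I"
    and s_sign: "s * s = 1"
    and Q_iff: "\<And>z. cline z \<in> Q \<longleftrightarrow> ip z z = 0 \<and> 0 < s * Re (ip z (cnj_vec z))"
    and c_diff: "\<And>t. t \<in> I \<Longrightarrow> c differentiable (at t)"
    and vel_sign: "\<And>t. t \<in> I \<Longrightarrow> 0 < s * ip (vel c t) (vel c t)"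
    and normal_orthonormal: "\<And>t. t \<in> I \<Longrightarrow> ip (A t) (A t) = - s" "\<And>t. t \<in> I \<Longrightarrow> ip (B t) (B t) = - s"
      "\<And>t. t \<in> I \<Longrightarrow> ip (A t) (B t) = 0"
    and vel_normal: "\<And>t. t \<in> I \<Longrightarrow> ip (vel c t) (A t) = 0" "\<And>t. t \<in> I \<Longrightarrow> ip (vel c t) (B t) = 0"
begin

lemma open_I: "open I" and zero_in_I: "0 \<in> I" and convex_I: "convex I"
  using r_pos by (auto simp: I_eq)

lemma form_on_curve:
  assumes "t \<in> I"
  defines "z \<equiv> bjorling_form (cvec (vel c t)) (cvec (A t)) (cvec (B t))"
  shows "ip z z = 0" "Re (ip z (cnj_vec z)) = 2 * ip (vel c t) (vel c t)"
  unfolding z_def using normal_orthonormal vel_normal assms(1) s_sign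
  by (intro bjorling_form_isotropic[where s = "- s"]; simp)+

text \<open>
  The essence of a solution, stated for sets that may meet \<open>I\<close> only in part and need not be
  simply connected, so that it makes sense on small discs. The sign condition says that
  \<open>f\<^sub>w\<close> stays in the quadric: the isotropy of the form is automatic.
\<close>

definition solution_on :: "complex set \<Rightarrow> (complex \<Rightarrow> complex ^ 4) \<Rightarrow> (complex \<Rightarrow> complex ^ 4) \<Rightarrow>
    (complex \<Rightarrow> complex ^ 4) \<Rightarrow> bool" where
  "solution_on U cw Aw Bw \<longleftrightarrow>
     holo_extension (I \<inter> complex_of_real -` U) (vel c) U cw \<and>
     holo_extension (I \<inter> complex_of_real -` U) A U Aw \<and>
     holo_extension (I \<inter> complex_of_real -` U) B U Bw \<and>
     (\<forall>w\<in>U. let z = bjorling_form (cw w) (Aw w) (Bw w) in 0 < s * Re (ip z (cnj_vec z)))"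

definition solvable :: "complex set \<Rightarrow> bool" where
  "solvable U \<longleftrightarrow> open U \<and> connected U \<and> I \<inter> complex_of_real -` U \<noteq> {} \<and>
     (\<exists>cw Aw Bw. solution_on U cw Aw Bw)"

lemma holomorphic_form:
  assumes "holo_extension (I \<inter> complex_of_real -` U) (vel c) U cw"
    "holo_extension (I \<inter> complex_of_real -` U) A U Aw" "holo_extension (I \<inter> complex_of_real -` U) B U Bw"
  shows "(\<lambda>w. bjorling_form (cw w) (Aw w) (Bw w) $ i) holomorphic_on U"
  using assms by (intro holomorphic_on_bjorling_form) (auto simp: holo_extension_def)

text \<open>
  Isotropy holds on \<open>I\<close> and extends by the identity theorem.
\<close>

lemma form_isotropic:
  assumes ext: "holo_extension (I \<inter> complex_of_real -` U) (vel c) U cw"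
    "holo_extension (I \<inter> complex_of_real -` U) A U Aw" "holo_extension (I \<inter> complex_of_real -` U) B U Bw"
    and U: "open U" "connected U" "I \<inter> complex_of_real -` U \<noteq> {}" "w \<in> U"
  defines "z \<equiv> \<lambda>w. bjorling_form (cw w) (Aw w) (Bw w)"
  shows "ip (z w) (z w) = 0"
proof -
  obtain t where t: "t \<in> I" "complex_of_real t \<in> U"
    using U(3) by auto
  show ?thesis
  proof (rule holomorphic_zero_on_reals[OF _ U(1,2) open_I t _ U(4)])
    show "(\<lambda>w. ip (z w) (z w)) holomorphic_on U"
      unfolding ip_def z_def by (intro holomorphic_intros holomorphic_form ext)
    show "ip (z (complex_of_real t)) (z (complex_of_real t)) = 0"
      if "t \<in> I" "complex_of_real t \<in> U" for t
      using form_on_curve(1)[OF that(1)] ext that by (simp add: z_def holo_extension_def)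
  qed
qed

text \<open>
  The sign condition is pointwise, so it passes from the pieces to the glued fields.
\<close>

lemma solvable_Union:
  assumes S: "S \<noteq> {}" "\<And>U. U \<in> S \<Longrightarrow> solvable U" and conn: "connected (\<Union>S)"
    and overlap: "\<And>U V w. U \<in> S \<Longrightarrow> V \<in> S \<Longrightarrow> w \<in> U \<inter> V \<Longrightarrow>
      \<exists>W. open W \<and> connected W \<and> I \<inter> complex_of_real -` W \<noteq> {} \<and> w \<in> W \<and> W \<subseteq> U \<inter> V"
  shows "solvable (\<Union>S)"
proof -
  have "\<forall>U\<in>S. \<exists>cw Aw Bw. solution_on U cw Aw Bw"
    using S(2) by (auto simp: solvable_def)
  then obtain cw Aw Bw where sol: "\<And>U. U \<in> S \<Longrightarrow> solution_on U (cw U) (Aw U) (Bw U)"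
    by metis
  have op: "\<And>U. U \<in> S \<Longrightarrow> open U"
    using S(2) by (auto simp: solvable_def)
  obtain cH where cH: "holo_extension (I \<inter> complex_of_real -` \<Union>S) (vel c) (\<Union>S) cH"
      "\<And>U w. U \<in> S \<Longrightarrow> w \<in> U \<Longrightarrow> cH w = cw U w"
    by (rule holo_extension_glue[OF open_I _ overlap, where g = "vel c" and h = cw])
      (use sol op in \<open>auto simp: solution_on_def\<close>)
  obtain AH where AH: "holo_extension (I \<inter> complex_of_real -` \<Union>S) A (\<Union>S) AH"
      "\<And>U w. U \<in> S \<Longrightarrow> w \<in> U \<Longrightarrow> AH w = Aw U w"
    by (rule holo_extension_glue[OF open_I _ overlap, where g = A and h = Aw])
      (use sol op in \<open>auto simp: solution_on_def\<close>)
  obtain BH where BH: "holo_extension (I \<inter> complex_of_real -` \<Union>S) B (\<Union>S) BH"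
      "\<And>U w. U \<in> S \<Longrightarrow> w \<in> U \<Longrightarrow> BH w = Bw U w"
    by (rule holo_extension_glue[OF open_I _ overlap, where g = B and h = Bw])
      (use sol op in \<open>auto simp: solution_on_def\<close>)
  have "solution_on (\<Union>S) cH AH BH"
    unfolding solution_on_def
  proof (intro conjI ballI cH AH BH)
    fix w assume "w \<in> \<Union>S"
    then obtain U where "U \<in> S" "w \<in> U"
      by blast
    then show "let z = bjorling_form (cH w) (AH w) (BH w) in 0 < s * Re (ip z (cnj_vec z))"
      using sol[of U] cH(2) AH(2) BH(2) by (simp add: solution_on_def)
  qed
  moreover have "I \<inter> complex_of_real -` \<Union>S \<noteq> {}"
  proof -
    obtain U where "U \<in> S" using S(1) by blast
    then have "I \<inter> complex_of_real -` U \<noteq> {}"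
      using S(2) by (simp add: solvable_def)
    then show ?thesis
      using \<open>U \<in> S\<close> by blast
  qed
  ultimately show ?thesis
    unfolding solvable_def using conn op by blast
qed

text \<open>
  The three fields extend to a small disc around \<open>t\<close>; the sign condition holds at \<open>t\<close> and
  therefore, by continuity, on a smaller disc.
\<close>

lemma solvable_ball:
  assumes t: "t \<in> I"
  obtains \<rho> where "\<rho> > 0" "\<And>x. \<bar>x - t\<bar> < \<rho> \<Longrightarrow> x \<in> I" "solvable (ball (complex_of_real t) \<rho>)"
proof -
  let ?B = "ball (complex_of_real t)"
  obtain r1 h1 where 1: "r1 > 0" "\<And>x. \<bar>x - t\<bar> < r1 \<Longrightarrow> x \<in> I"
      "holo_extension (I \<inter> complex_of_real -` ?B r1) c (?B r1) h1"
    by (rule real_analytic_local_extension[OF analytic(1) open_I t]) blast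
  obtain r2 h2 where 2: "r2 > 0" "holo_extension (I \<inter> complex_of_real -` ?B r2) A (?B r2) h2"
    by (rule real_analytic_local_extension[OF analytic(2) open_I t]) blast
  obtain r3 h3 where 3: "r3 > 0" "holo_extension (I \<inter> complex_of_real -` ?B r3) B (?B r3) h3"
    by (rule real_analytic_local_extension[OF analytic(3) open_I t]) blast
  have ext_vel: "holo_extension (I \<inter> complex_of_real -` ?B r1) (vel c) (?B r1) (cderiv h1)"
    by (rule holo_extension_vel[OF 1(3)]) (auto simp: open_I c_diff)
  define \<delta> where "\<delta> = min r1 (min r2 r3)"
  have \<delta>: "\<delta> > 0" "?B \<delta> \<subseteq> ?B r1" "?B \<delta> \<subseteq> ?B r2" "?B \<delta> \<subseteq> ?B r3"
    using 1 2 3 by (auto simp: \<delta>_def)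
  note ext = holo_extension_subset[OF ext_vel \<delta>(2)] holo_extension_subset[OF 2(2) \<delta>(3)]
    holo_extension_subset[OF 3(2) \<delta>(4)]
  define z where "z w = bjorling_form (cderiv h1 w) (h2 w) (h3 w)" for w
  define F where "F w = s * Re (ip (z w) (cnj_vec (z w)))" for w
  have "continuous_on (?B \<delta>) (\<lambda>w. \<chi> i. z w $ i)"
    unfolding z_def by (intro continuous_on_vec_lambda holomorphic_on_imp_continuous_on holomorphic_form ext)
  then have "continuous_on (?B \<delta>) z"
    by simp
  then have "continuous_on (?B \<delta>) F"
    unfolding F_def ip_def cnj_vec_def by (auto intro!: continuous_intros)
  then have opF: "open (?B \<delta> \<inter> F -` {0<..})"
    by (rule continuous_open_preimage) auto
  have "F (complex_of_real t) = s * (2 * ip (vel c t) (vel c t))"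
    using form_on_curve(2)[OF t] ext t \<delta>(1) by (simp add: F_def z_def holo_extension_def)
  then have "complex_of_real t \<in> ?B \<delta> \<inter> F -` {0<..}"
    using vel_sign[OF t] \<delta>(1) by simp
  then obtain \<rho> where \<rho>: "\<rho> > 0" "?B \<rho> \<subseteq> ?B \<delta> \<inter> F -` {0<..}"
    using opF open_contains_ball by blast
  have sub: "?B \<rho> \<subseteq> ?B \<delta>"
    using \<rho>(2) by blast
  have "solution_on (?B \<rho>) (cderiv h1) h2 h3"
    unfolding solution_on_def
    using holo_extension_subset[OF ext(1) sub] holo_extension_subset[OF ext(2) sub]
      holo_extension_subset[OF ext(3) sub] \<rho>(2)
    by (auto simp: F_def z_def Let_def)
  moreover have "I \<inter> complex_of_real -` ?B \<rho> \<noteq> {}"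
    using t \<rho>(1) by auto
  ultimately have "solvable (?B \<rho>)"
    unfolding solvable_def by auto
  moreover have "x \<in> I" if "\<bar>x - t\<bar> < \<rho>" for x
  proof -
    have "complex_of_real x \<in> ?B \<rho>"
      using that by (simp add: dist_of_real dist_real_def abs_minus_commute)
    then have "complex_of_real x \<in> ?B r1"
      using sub \<delta>(2) by blast
    then show ?thesis
      by (intro 1(2)) (simp add: dist_of_real dist_real_def abs_minus_commute)
  qed
  ultimately show thesis
    using that \<rho>(1) by blast
qed

text \<open>
  The neighbourhood is a union of discs centred on \<open>I\<close>. Whenever two of them meet at \<open>w\<close>,
  their intersection is convex and contains \<open>Re w \<in> I\<close>, so the extensions glue. Each disc
  contains the vertical segment from any of its points to the real axis.
\<close>

lemma solvable_neighbourhood: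
  obtains M where "solvable M" "simply_connected M" "complex_of_real ` I \<subseteq> M"
proof -
  define S where "S = {ball (complex_of_real t) \<rho> | t \<rho>. t \<in> I \<and> \<rho> > 0 \<and>
    (\<forall>x. \<bar>x - t\<bar> < \<rho> \<longrightarrow> x \<in> I) \<and> solvable (ball (complex_of_real t) \<rho>)}"
  have cover: "complex_of_real ` I \<subseteq> \<Union>S"
  proof
    fix w assume "w \<in> complex_of_real ` I"
    then obtain t where t: "t \<in> I" "w = complex_of_real t" by blast
    obtain \<rho> where \<rho>: "\<rho> > 0" "\<And>x. \<bar>x - t\<bar> < \<rho> \<Longrightarrow> x \<in> I" "solvable (ball (complex_of_real t) \<rho>)"
      using solvable_ball[OF t(1)] by blast
    then have "ball (complex_of_real t) \<rho> \<in> S"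
      unfolding S_def using t(1) by blast
    then show "w \<in> \<Union>S"
      using \<rho>(1) t(2) by (meson UnionI centre_in_ball)
  qed
  have Re_mem: "Re w \<in> I" "complex_of_real (Re w) \<in> U" "convex U" "open U" "solvable U" if "U \<in> S" "w \<in> U" for U w
  proof -
    obtain t \<rho> where U: "U = ball (complex_of_real t) \<rho>" "\<And>x. \<bar>x - t\<bar> < \<rho> \<Longrightarrow> x \<in> I" "solvable U"
      using \<open>U \<in> S\<close> by (auto simp: S_def)
    have "\<bar>Re w - t\<bar> \<le> cmod (w - complex_of_real t)"
      using abs_Re_le_cmod[of "w - complex_of_real t"] by simp
    then have "\<bar>Re w - t\<bar> < \<rho>"
      using \<open>w \<in> U\<close> by (simp add: U(1) dist_norm norm_minus_commute)
    then show "Re w \<in> I" "complex_of_real (Re w) \<in> U" "convex U" "open U" "solvable U"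
      using U by (auto simp: dist_of_real dist_real_def abs_minus_commute)
  qed
  have sc: "simply_connected (\<Union>S)"
  proof (rule simply_connected_vertically_starlike)
    show "closed_segment w (complex_of_real (Re w)) \<subseteq> \<Union>S" if w: "w \<in> \<Union>S" for w
    proof -
      obtain U where U: "U \<in> S" "w \<in> U"
        using w by blast
      then have "closed_segment w (complex_of_real (Re w)) \<subseteq> U"
        using Re_mem[OF U] by (simp add: closed_segment_subset)
      then show ?thesis
        using U(1) by blast
    qed
    have "\<Union>S \<inter> \<real> = complex_of_real ` I"
    proof (intro equalityI subsetI)
      fix w assume "w \<in> \<Union>S \<inter> \<real>"
      then obtain U where "U \<in> S" "w \<in> U" "complex_of_real (Re w) = w"
        by auto
      then show "w \<in> complex_of_real ` I"
        using Re_mem(1) by (metis imageI)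
    qed (use cover in auto)
    then show "convex (\<Union>S \<inter> \<real>)"
      by (simp add: convex_linear_image convex_I linear_of_real)
  qed
  have "solvable (\<Union>S)"
  proof (rule solvable_Union)
    show "S \<noteq> {}"
      using cover zero_in_I by blast
    show "connected (\<Union>S)"
      using sc by (rule simply_connected_imp_connected)
    show "solvable U" if "U \<in> S" for U
      using that by (auto simp: S_def)
    show "\<exists>W. open W \<and> connected W \<and> I \<inter> complex_of_real -` W \<noteq> {} \<and> w \<in> W \<and> W \<subseteq> U \<inter> V"
      if "U \<in> S" "V \<in> S" "w \<in> U \<inter> V" for U V w
    proof (intro exI conjI)
      have wU: "w \<in> U" and wV: "w \<in> V"
        using that(3) by auto
      show "open (U \<inter> V)" "connected (U \<inter> V)"
        using Re_mem(3,4)[OF that(1) wU] Re_mem(3,4)[OF that(2) wV]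
        by (auto intro: convex_connected convex_Int)
      show "I \<inter> complex_of_real -` (U \<inter> V) \<noteq> {}"
        using Re_mem(1,2)[OF that(1) wU] Re_mem(2)[OF that(2) wV] by auto
    qed (use that in auto)
  qed
  then show thesis
    using that sc cover by blast
qed

text \<open>
  In a chain, the intersection of two members is one of them, so that the overlap condition
  for gluing is trivial.
\<close>

lemma solvable_Union_chain:
  assumes "C \<noteq> {}" "subset.chain X C" and C: "\<And>U. U \<in> C \<Longrightarrow> solvable U" "\<And>U. U \<in> C \<Longrightarrow> simply_connected U"
  shows "solvable (\<Union>C)" "simply_connected (\<Union>C)"
proof -
  show sc: "simply_connected (\<Union>C)"
    by (rule simply_connected_Union_chain[OF assms(2)]) (use C in \<open>auto simp: solvable_def\<close>)
  show "solvable (\<Union>C)"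
  proof (rule solvable_Union)
    show "\<exists>W. open W \<and> connected W \<and> I \<inter> complex_of_real -` W \<noteq> {} \<and> w \<in> W \<and> W \<subseteq> U \<inter> V"
      if "U \<in> C" "V \<in> C" "w \<in> U \<inter> V" for U V w
    proof -
      have "U \<inter> V = U \<or> U \<inter> V = V"
        using that assms(2) unfolding subset.chain_def by blast
      then have "U \<inter> V \<in> C"
        using that by auto
      then show ?thesis
        using C(1) that(3) unfolding solvable_def by blast
    qed
  qed (use sc assms in \<open>auto intro: simply_connected_imp_connected\<close>)
qed

section \<open>Solutions on simply connected domains\<close>

lemma solution_potential:
  assumes M: "open M" "simply_connected M" "complex_of_real ` I \<subseteq> M"
    and ext: "holo_extension I (vel c) M cw" "holo_extension I A M Aw" "holo_extension I B M Bw"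
  defines "z \<equiv> \<lambda>w. bjorling_form (cw w) (Aw w) (Bw w)"
  obtains F where "\<And>i. (\<lambda>w. F w $ i) holomorphic_on M" "\<And>w. w \<in> M \<Longrightarrow> cderiv F w = z w" "F 0 = 0"
    "\<And>w J. w \<in> M \<Longrightarrow> has_integral_from_to z J M 0 w \<longleftrightarrow> J = F w"
proof -
  have "0 \<in> M"
    using M(3) zero_in_I by force
  have trace: "I \<inter> complex_of_real -` M = I"
    using M(3) by auto
  have "(\<lambda>w. z w $ i) holomorphic_on M" for i
    unfolding z_def by (rule holomorphic_form) (simp_all add: trace ext)
  then obtain F where F: "\<And>w i. w \<in> M \<Longrightarrow> ((\<lambda>w. F w $ i) has_field_derivative z w $ i) (at w)"
    "\<And>w J. w \<in> M \<Longrightarrow> has_integral_from_to z J M 0 w \<longleftrightarrow> J = F w" "F 0 = 0"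
    by (rule holomorphic_potential[OF M(1,2) \<open>0 \<in> M\<close>, of z]) (rule that)
  have "(\<lambda>w. F w $ i) holomorphic_on M" for i
    unfolding holomorphic_on_open[OF M(1)] using F(1) by blast
  moreover have "cderiv F w = z w" if "w \<in> M" for w
    using DERIV_imp_deriv[OF F(1)[OF that]] by (simp add: cderiv_def)
  ultimately show thesis
    by (rule that[OF _ _ F(3,2)])
qed

text \<open>
  The integral condition forces \<open>f\<close> to be the real part of the primitive, so that
  \<open>d_w f\<close> is half the form and its quadric gives the sign condition. Together with the next
  lemma this reduces the notion of a solution to the local sign condition, which is what makes
  unions of domains tractable.
\<close>

lemma bjorling_domain_imp_solvable:
  assumes "bjorling_domain Q I c A B M"
  shows "solvable M" "simply_connected M" "complex_of_real ` I \<subseteq> M"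
proof -
  obtain cw Aw Bw f where M: "open M" "connected M" "simply_connected M" "complex_of_real ` I \<subseteq> M"
    and ext: "holo_extension I (vel c) M cw" "holo_extension I A M Aw" "holo_extension I B M Bw"
    and f: "\<forall>w\<in>M. \<exists>J. has_integral_from_to
        (\<lambda>\<xi>. cw \<xi> - \<i> *s ccross (cw \<xi>) (Aw \<xi>) (Bw \<xi>)) J M 0 w \<and> f w = c 0 + Re_vec J"
    and f_Q: "\<forall>w\<in>M. cline (d_w f w) \<in> Q"
    using assms unfolding bjorling_domain_def unique_holo_extension_def
    by (elim exE conjE) (rule that; assumption)
  show "simply_connected M" "complex_of_real ` I \<subseteq> M"
    by fact+
  define z where "z = (\<lambda>w. bjorling_form (cw w) (Aw w) (Bw w))"
  obtain F where F: "\<And>i. (\<lambda>w. F w $ i) holomorphic_on M" "\<And>w. w \<in> M \<Longrightarrow> cderiv F w = z w"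
    "\<And>w J. w \<in> M \<Longrightarrow> has_integral_from_to z J M 0 w \<longleftrightarrow> J = F w"
    unfolding z_def by (rule solution_potential[OF M(1,3,4) ext]) blast
  have fF: "f w = c 0 + Re_vec (F w)" if "w \<in> M" for w
    using bspec[OF f that] F(3)[OF that] by (auto simp: z_def bjorling_form_def)
  have "0 < s * Re (ip (z w) (cnj_vec (z w)))" if "w \<in> M" for w
  proof -
    have "d_w f w = (1/2) *s z w"
      using Re_vec_holomorphic_partials(3)[OF M(1) that F(1) fF] F(2)[OF that] by simp
    then have "0 < s * Re (ip ((1/2) *s z w) (cnj_vec ((1/2) *s z w)))"
      using bspec[OF f_Q that] Q_iff by simp
    then show ?thesis
      unfolding Re_ip_scale_cnj by (simp add: norm_divide power_divide zero_less_mult_iff)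
  qed
  moreover have trace: "I \<inter> complex_of_real -` M = I"
    using M(4) by auto
  ultimately have "solution_on M cw Aw Bw"
    using ext by (simp add: solution_on_def z_def)
  then show "solvable M"
    unfolding solvable_def trace using M zero_in_I by blast
qed

text \<open>
  All properties of the surface are read off its differential \<open>X \<mapsto> Re (X z)\<close>, where \<open>z\<close> is
  the isotropic form.
\<close>

lemma solvable_imp_bjorling_domain:
  assumes "solvable M" and sc: "simply_connected M" and IM: "complex_of_real ` I \<subseteq> M"
  shows "bjorling_domain Q I c A B M"
proof -
  have trace: "I \<inter> complex_of_real -` M = I"
    using IM by auto
  obtain cw Aw Bw where M: "open M" "connected M" and sol: "solution_on M cw Aw Bw"
    using assms(1) by (auto simp: solvable_def)
  then have ext: "holo_extension I (vel c) M cw" "holo_extension I A M Aw" "holo_extension I B M Bw"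
    by (auto simp: solution_on_def trace)
  have unique: "unique_holo_extension I g M h" if "holo_extension I g M h" for g h
    unfolding unique_holo_extension_def
  proof (intro conjI allI impI ballI that)
    fix h' w assume "holo_extension I g M h'" "w \<in> M"
    then show "h' w = h w"
      using holo_extension_unique[of I M g h' h w] that M open_I zero_in_I by (auto simp: trace)
  qed
  define z where "z = (\<lambda>w. bjorling_form (cw w) (Aw w) (Bw w))"
  obtain F where hol: "\<And>i. (\<lambda>w. F w $ i) holomorphic_on M" and F': "\<And>w. w \<in> M \<Longrightarrow> cderiv F w = z w"
    and F0: "F 0 = 0" and J: "\<And>w J. w \<in> M \<Longrightarrow> has_integral_from_to z J M 0 w \<longleftrightarrow> J = F w"
    unfolding z_def by (rule solution_potential[OF M(1) sc IM ext]) blast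
  define f where "f w = c 0 + Re_vec (F w)" for w
  define l where "l w = Re (ip (z w) (cnj_vec (z w))) / 2" for w
  have l: "0 < s * l w" if "w \<in> M" for w
    using sol that by (simp add: solution_on_def l_def z_def Let_def)
  have iso: "ip (z w) (z w) = 0" if "w \<in> M" for w
    unfolding z_def using ext M that zero_in_I by (intro form_isotropic[of M]) (auto simp: trace)
  have D: "(f has_derivative (\<lambda>X. Re_vec (X *s z w))) (at w)" if "w \<in> M" for w
    using has_derivative_Re_vec_holomorphic[OF M(1) that hol f_def] F'[OF that] by simp
  have fd: "frechet_derivative f (at w) = (\<lambda>X. Re_vec (X *s z w))" if "w \<in> M" for w
    by (rule frechet_derivative_at[OF D[OF that], symmetric])
  have lin: "linear (frechet_derivative f (at w))" if "w \<in> M" for w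
    using has_derivative_linear[OF D[OF that]] fd[OF that] by simp
  have conf: "induced_metric f w X Y = l w * (X \<bullet> Y)" if "w \<in> M" for w X Y
    by (simp add: induced_metric_def fd[OF that] l_def isotropic_conformal[OF iso[OF that]])
  have l0: "l w \<noteq> 0" if "w \<in> M" for w
    using l[OF that] by auto
  have "inj (frechet_derivative f (at w))" if w: "w \<in> M" for w
    unfolding linear_injective_0[OF lin[OF w]]
  proof (intro allI impI)
    fix X assume "frechet_derivative f (at w) X = 0"
    then have "l w * (X \<bullet> X) = 0"
      by (simp add: conf[OF w, symmetric] induced_metric_def ip_zero)
    then show "X = 0"
      using l0[OF w] by simp
  qed
  then have immersion: "immersion_on M f"
    using Ck_on_Re_vec_holomorphic[OF M(1) hol f_def] by (simp add: immersion_on_def)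
  have conformal: "conformal_on M f"
    unfolding conformal_on_def by (intro ballI exI allI) (rule conf)
  have regular: "\<not> metric_singularity f w" if w: "w \<in> M" for w
  proof
    assume "metric_singularity f w"
    then obtain X :: complex where X: "X \<noteq> 0" "\<forall>Y. l w * (X \<bullet> Y) = 0"
      unfolding metric_singularity_def conf[OF w] by blast
    then show False
      using l0[OF w] X(1) spec[OF X(2), of X] by simp
  qed
  have quadric: "cline (d_w f w) \<in> Q" if "w \<in> M" for w
  proof -
    have "d_w f w = (1/2) *s z w"
      using Re_vec_holomorphic_partials(3)[OF M(1) that hol f_def] F'[OF that] by simp
    then show ?thesis
      using l[OF that] iso[OF that]
      by (simp add: Q_iff ip_scale_scale Re_ip_scale_cnj l_def norm_divide power_divide)
  qed
  have curve: "z (complex_of_real t) = cvec (vel c t) + \<i> *s cvec (- cross (vel c t) (A t) (B t))"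
    if "t \<in> I" for t
    using ext that by (simp add: z_def holo_extension_def bjorling_form_cvec)
  have on_curve: "f (complex_of_real t) = c t" if t_I: "t \<in> I" for t
  proof -
    have "((\<lambda>t. f (complex_of_real t) - c t) has_derivative (\<lambda>x. 0)) (at t within I)" if t: "t \<in> I" for t
    proof -
      have "complex_of_real t \<in> M"
        using t IM by auto
      then have "((\<lambda>t. f (complex_of_real t)) has_derivative (\<lambda>x. Re_vec (complex_of_real x *s z (complex_of_real t)))) (at t within I)"
        by (intro has_derivative_compose[OF bounded_linear_imp_has_derivative[OF bounded_linear_of_real] D])
      moreover have "(\<lambda>x. Re_vec (complex_of_real x *s z (complex_of_real t))) = (\<lambda>x. x *\<^sub>R vel c t)"
        by (simp add: curve[OF t] fun_eq_iff vec_eq_iff Re_vec_def cvec_def)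
      moreover have "(c has_derivative (\<lambda>x. x *\<^sub>R vel c t)) (at t within I)"
        using c_diff[OF t] unfolding vel_def has_vector_derivative_def[symmetric] vector_derivative_works
        by (rule has_vector_derivative_at_within)
      ultimately have "((\<lambda>t. f (complex_of_real t) - c t) has_derivative (\<lambda>x. x *\<^sub>R vel c t - x *\<^sub>R vel c t)) (at t within I)"
        by (simp only: has_derivative_diff)
      then show ?thesis
        by simp
    qed
    then obtain k where k: "\<forall>t\<in>I. f (complex_of_real t) - c t = k"
      using has_derivative_zero_constant[OF convex_I, of "\<lambda>t. f (complex_of_real t) - c t"] by blast
    have "f 0 = c 0"
      by (simp add: f_def F0 Re_vec_def vec_eq_iff)
    then show ?thesis
      using bspec[OF k t_I] bspec[OF k zero_in_I] by simp
  qed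
  have normal: "normal_plane f (complex_of_real t) = span {A t, B t}" if t: "t \<in> I" for t
  proof -
    let ?n = "cross (vel c t) (A t) (B t)"
    have tM: "complex_of_real t \<in> M"
      using t IM by auto
    have "frechet_derivative f (at (complex_of_real t)) X = Re X *\<^sub>R vel c t + Im X *\<^sub>R ?n" for X
      by (simp add: fd[OF tM] curve[OF t] vec_eq_iff Re_vec_def cvec_def)
    then have "normal_plane f (complex_of_real t) =
        {n. \<forall>X. Re X * ip (vel c t) n + Im X * ip ?n n = 0}"
      by (simp add: normal_plane_def tangent_plane_def ip_add_left ip_scaleR_left)
    also have "\<dots> = {n. ip (vel c t) n = 0 \<and> ip ?n n = 0}"
    proof (intro Collect_cong iffI)
      fix n assume *: "\<forall>X. Re X * ip (vel c t) n + Im X * ip ?n n = 0"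
      show "ip (vel c t) n = 0 \<and> ip ?n n = 0"
        using *[rule_format, of 1] *[rule_format, of \<i>] by simp
    qed simp
    also have "\<dots> = span {A t, B t}"
      using normal_orthonormal[OF t] vel_normal[OF t] s_sign vel_sign[OF t]
      by (intro orthogonal_complement_cross[where s = "- s"]) auto
    finally show ?thesis .
  qed
  have minimal: "mean_curvature f w = 0" if "w \<in> M" for w
    by (rule mean_curvature_conformal_harmonic[OF lin[OF that] l0[OF that] conf[OF that]
          Re_vec_holomorphic_harmonic[OF M(1) that hol f_def]])
  have integral: "\<exists>J. has_integral_from_to (\<lambda>\<xi>. cw \<xi> - \<i> *s ccross (cw \<xi>) (Aw \<xi>) (Bw \<xi>)) J M 0 w \<and>
      f w = c 0 + Re_vec J" if "w \<in> M" for w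
    using J[OF that, of "F w"] by (auto simp: f_def z_def bjorling_form_def)
  show ?thesis
    unfolding bjorling_domain_def
    by (intro conjI M sc IM, rule exI[of _ cw], rule exI[of _ Aw], rule exI[of _ Bw], rule exI[of _ f],
        intro conjI ballI unique ext integral immersion conformal regular quadric on_curve normal minimal)
qed

text \<open>
  Zorn's lemma; the union of a chain of domains is again one because the defining conditions
  reduce to the local ones that glue.
\<close>

lemma maximal_bjorling_domain:
  "\<exists>M. bjorling_domain Q I c A B M \<and>
     (\<forall>M'. bjorling_domain Q I c A B M' \<and> M \<subseteq> M' \<longrightarrow> M' = M)"
proof -
  have "\<exists>M\<in>Collect (bjorling_domain Q I c A B). \<forall>X\<in>Collect (bjorling_domain Q I c A B). M \<subseteq> X \<longrightarrow> X = M"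
  proof (rule subset_Zorn_nonempty)
    obtain M where "solvable M" "simply_connected M" "complex_of_real ` I \<subseteq> M"
      by (rule solvable_neighbourhood)
    then show "Collect (bjorling_domain Q I c A B) \<noteq> {}"
      using solvable_imp_bjorling_domain by blast
    fix C assume C: "C \<noteq> {}" "subset.chain (Collect (bjorling_domain Q I c A B)) C"
    then have *: "bjorling_domain Q I c A B U" if "U \<in> C" for U
      using that by (auto simp: subset.chain_def)
    note * = bjorling_domain_imp_solvable[OF *]
    have "complex_of_real ` I \<subseteq> \<Union>C"
      using C(1) *(3) by blast
    then show "\<Union>C \<in> Collect (bjorling_domain Q I c A B)"
      using solvable_imp_bjorling_domain solvable_Union_chain[OF C *(1,2)] by blast
  qed
  then show ?thesis
    by blast
qed

end

section \<open>The two causal types\<close>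

lemma ip_span_zero:
  fixes x :: "real ^ 4"
  assumes "y \<in> span S" "\<And>n. n \<in> S \<Longrightarrow> ip x n = 0"
  shows "ip x y = 0"
  using assms(1)
  by (induction rule: span_induct_alt) (simp_all add: ip_zero ip_add_right ip_scaleR_right assms(2))

lemma good_frame_orthogonal:
  assumes "good_frame s I c T N B0 R" "t \<in> I" "y \<in> span {N t, B0 t, R t}"
  shows "ip (vel c t) y = 0"
proof -
  have frame: "oriented_orthonormal_basis (T t) (N t) (B0 t) (R t)"
    and v: "\<exists>v::real. vel c t = v *\<^sub>R T t"
    using assms(1,2) unfolding good_frame_def by blast+
  have "ip (T t) y = 0"
    using assms(3)
    by (rule ip_span_zero) (use frame in \<open>auto simp: oriented_orthonormal_basis_def orthonormal_pair_def\<close>)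
  then show ?thesis
    using v by (auto simp: ip_scaleR_left)
qed

theorem theorem4p8:
  fixes r :: real and I :: "real set" and c T N B0 R A B :: "real \<Rightarrow> real ^ 4"
  assumes "r > 0" and "I = {-r<..<r}"
    and "real_analytic_on c I" and "real_analytic_on A I" and "real_analytic_on B I"
    and "\<And>t. t \<in> I \<Longrightarrow> orthonormal_pair (A t) (B t)"
    and "\<And>t. t \<in> I \<Longrightarrow> span {A t, B t} \<subseteq> span {N t, B0 t, R t}"
  shows "(good_positive_curve I c T N B0 R \<and>
          (\<forall>t\<in>I. cline (cvec (A t) + \<i> *s cvec (B t)) \<in> Q_neg) \<longrightarrow>
            (\<exists>M. bjorling_domain Q_pos I c A B M \<and>
                 (\<forall>M'. bjorling_domain Q_pos I c A B M' \<and> M \<subseteq> M' \<longrightarrow> M' = M))) \<and>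
         (good_negative_curve I c T N B0 R \<and>
          (\<forall>t\<in>I. cline (cvec (A t) + \<i> *s cvec (B t)) \<in> Q_pos) \<longrightarrow>
            (\<exists>M. bjorling_domain Q_neg I c A B M \<and>
                 (\<forall>M'. bjorling_domain Q_neg I c A B M' \<and> M \<subseteq> M' \<longrightarrow> M' = M)))"
proof (intro conjI impI; elim conjE)
  assume c: "good_positive_curve I c T N B0 R"
    and AB: "\<forall>t\<in>I. cline (cvec (A t) + \<i> *s cvec (B t)) \<in> Q_neg"
  have "ip (A t) (A t) = - 1 \<and> ip (B t) (B t) = - 1" if "t \<in> I" for t
    using AB assms(6)[OF that] that
    by (auto simp: cline_mem_Q_neg ip_cvec_add_i ip_cvec_add_i_cnj orthonormal_pair_def complex_eq_iff)
  moreover have "ip (vel c t) (A t) = 0" "ip (vel c t) (B t) = 0" if "t \<in> I" for t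
    using c assms(7)[OF that] that
    by (auto simp: good_positive_curve_def span_base intro!: good_frame_orthogonal)
  ultimately interpret bjorling_data 1 r Q_pos I c A B
    using assms c
    by unfold_locales
      (auto simp: cline_mem_Q_pos good_positive_curve_def positive_curve_def regular_curve_def orthonormal_pair_def)
  show "\<exists>M. bjorling_domain Q_pos I c A B M \<and>
      (\<forall>M'. bjorling_domain Q_pos I c A B M' \<and> M \<subseteq> M' \<longrightarrow> M' = M)"
    by (rule maximal_bjorling_domain)
next
  assume c: "good_negative_curve I c T N B0 R"
    and AB: "\<forall>t\<in>I. cline (cvec (A t) + \<i> *s cvec (B t)) \<in> Q_pos"
  have "ip (A t) (A t) = 1 \<and> ip (B t) (B t) = 1" if "t \<in> I" for t
    using AB assms(6)[OF that] that
    by (auto simp: cline_mem_Q_pos ip_cvec_add_i ip_cvec_add_i_cnj orthonormal_pair_def complex_eq_iff)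
  moreover have "ip (vel c t) (A t) = 0" "ip (vel c t) (B t) = 0" if "t \<in> I" for t
    using c assms(7)[OF that] that
    by (auto simp: good_negative_curve_def span_base intro!: good_frame_orthogonal)
  ultimately interpret bjorling_data "-1" r Q_neg I c A B
    using assms c
    by unfold_locales
      (auto simp: cline_mem_Q_neg good_negative_curve_def negative_curve_def regular_curve_def orthonormal_pair_def)
  show "\<exists>M. bjorling_domain Q_neg I c A B M \<and>
      (\<forall>M'. bjorling_domain Q_neg I c A B M' \<and> M \<subseteq> M' \<longrightarrow> M' = M)"
    by (rule maximal_bjorling_domain)
qed

end
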